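(* Let $\mathbb{K}$ be an algebraically closed field of characteristic $0$. Let $\mathcal{B}$ be a bialgebra over $\mathbb{K}$ and $e_2$ its unit. Let $\mathcal{B}'$ be the result of adjoining a unit $e_1$ to $\mathcal{B}$ with respect to the multiplication. Extend the comultiplication $\Delta$ and counit $\varepsilon$ of $\mathcal{B}$ linearly to $\mathcal{B}'$ by $$\Delta(e_1)=(e_1-e_2)\otimes(e_1-e_2)+e_2\otimes e_2,\qquad \varepsilon(e_1)=2.$$ Then $\mathcal{B}'$ becomes a weak bialgebra.
   Context: Adjoining a unit $e_1$ to $\mathcal{B}$ means forming $\mathcal{B}'=\mathcal{B}\oplus\mathbb{K}e_1$ with the multiplication extending that of $\mathcal{B}$ for which $e_1$ is the unit. A bialgebra is assumed unital and counital, with $\Delta$ and $\varepsilon$ unital algebra morphisms. Weak bialgebra. Write $xy=m(x\otimes y)$ and use Sweedler notation $\Delta(x)=x_{(1)}\otimes x_{(2)}$ (summation understood). A weak bialgebra is a quintuple $(V,m,\eta,\Delta,\varepsilon)$ with linear maps $m:V\otimes V\to V$, $\eta:\mathbb{K}\to V$ (write $1=\eta(1)$), $\Delta:V\to V\otimes V$, $\varepsilon:V\to\mathbb{K}$ such that: (1) $(V,m,\eta)$ is a unital associative algebra; (2) $(V,\Delta,\varepsilon)$ is a coassociative counital coalgebra; (3) for all $x,y,z\in V$: $\Delta(xy)=\Delta(x)\bullet\Delta(y)$; $(\Delta\otimes \mathrm{id})\Delta(1)=(\Delta(1)\otimes 1)\bullet(1\otimes\Delta(1))=(1\otimes\Delta(1))\bullet(\Delta(1)\otimes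 1)$; and $\varepsilon(xyz)=\varepsilon(xy_{(1)})\,\varepsilon(y_{(2)}z)$. Here $\bullet$ is the usual componentwise multiplication on tensor powers of $V$. *)

theory Defs
  imports
    "HOL-Computational_Algebra.Polynomial"
    "HOL-Library.Poly_Mapping"
    "HOL-Library.Product_Plus"
begin

section \<open>Tensor powers of a vector space\<close>

text \<open>
  A vector space over \<open>'k\<close> is a type \<open>'v\<close> with a scalar multiplication \<open>s\<close> such that
  \<open>vector_space s\<close>. Its tensor powers are constructed in the usual way: formal linear combinations
  of lists (the list \<open>[x1, ..., xn]\<close> standing for the pure tensor of \<open>x1, ..., xn\<close>) modulo the
  subspace spanned by the multilinearity relations. Lists of all lengths are treated at once, so
  the quotient is the tensor algebra; since every relation is homogeneous, the classes of
  combinations of lists of length \<open>n\<close> form the \<open>n\<close>-th tensor power. Degree 0 is the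
  ground field, and the identification of the various bracketings of iterated tensor products is
  built in.
\<close>

type_synonym ('k, 'v) formal = "'v list \<Rightarrow>\<^sub>0 'k"
type_synonym ('k, 'v) tensor = "('k, 'v) formal set"

definition formal_scale :: "'k::field \<Rightarrow> ('k, 'v) formal \<Rightarrow> ('k, 'v) formal" where
  "formal_scale c p = Poly_Mapping.map ((*) c) p"

definition multilinear_relations ::
  "('k::field \<Rightarrow> 'v::ab_group_add \<Rightarrow> 'v) \<Rightarrow> ('k, 'v) formal set" where
  "multilinear_relations s =
     {Poly_Mapping.single (xs @ (a + b) # ys) 1 - Poly_Mapping.single (xs @ a # ys) 1
        - Poly_Mapping.single (xs @ b # ys) 1 | xs a b ys. True} \<union>
     {Poly_Mapping.single (xs @ s c a # ys) 1
        - formal_scale c (Poly_Mapping.single (xs @ a # ys) 1) | xs c a ys. True}"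

definition tensor_class ::
  "('k::field \<Rightarrow> 'v::ab_group_add \<Rightarrow> 'v) \<Rightarrow> ('k, 'v) formal \<Rightarrow> ('k, 'v) tensor" where
  "tensor_class s p = {q. q - p \<in> module.span formal_scale (multilinear_relations s)}"

definition tensor_power ::
  "('k::field \<Rightarrow> 'v::ab_group_add \<Rightarrow> 'v) \<Rightarrow> nat \<Rightarrow> ('k, 'v) tensor set" where
  "tensor_power s n = tensor_class s ` {p. \<forall>xs \<in> Poly_Mapping.keys p. length xs = n}"

definition pure_tensor ::
  "('k::field \<Rightarrow> 'v::ab_group_add \<Rightarrow> 'v) \<Rightarrow> 'v list \<Rightarrow> ('k, 'v) tensor" where
  "pure_tensor s xs = tensor_class s (Poly_Mapping.single xs 1)"

text \<open>
  The operations on classes below are defined on a representative. A representative of a tensor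
  of degree \<open>n\<close> may also contain lists of other lengths, whose contribution is a relation;
  this is harmless as long as the maps being extended are multilinear in every degree, and
  therefore they are set to zero in the degrees where they are not meant to be applied.
\<close>

definition tensor_rep :: "('k, 'v) tensor \<Rightarrow> ('k::field, 'v) formal" where
  "tensor_rep t = (SOME p. p \<in> t)"

definition tensor_zero :: "('k::field \<Rightarrow> 'v::ab_group_add \<Rightarrow> 'v) \<Rightarrow> ('k, 'v) tensor" where
  "tensor_zero s = tensor_class s 0"

definition tensor_add ::
  "('k::field \<Rightarrow> 'v::ab_group_add \<Rightarrow> 'v) \<Rightarrow> ('k, 'v) tensor \<Rightarrow> ('k, 'v) tensor \<Rightarrow> ('k, 'v) tensor"
  where "tensor_add s t u = tensor_class s (tensor_rep t + tensor_rep u)"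

definition tensor_scale ::
  "('k::field \<Rightarrow> 'v::ab_group_add \<Rightarrow> 'v) \<Rightarrow> 'k \<Rightarrow> ('k, 'v) tensor \<Rightarrow> ('k, 'v) tensor"
  where "tensor_scale s c t = tensor_class s (formal_scale c (tensor_rep t))"

definition linear_extension ::
  "('k::field \<Rightarrow> 'w::ab_group_add \<Rightarrow> 'w) \<Rightarrow> ('v list \<Rightarrow> 'w) \<Rightarrow> ('k, 'v) formal \<Rightarrow> 'w" where
  "linear_extension s f p = (\<Sum>xs \<in> Poly_Mapping.keys p. s (Poly_Mapping.lookup p xs) (f xs))"

text \<open>
  The linear maps on tensors induced by a multilinear map \<open>f\<close>, with values in a vector space
  \<open>'w\<close> and in the tensor powers of a vector space \<open>'w\<close>, respectively. In both cases \<open>s\<close>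
  is the scalar multiplication of \<open>'w\<close>.
\<close>

definition tensor_lift ::
  "('k::field \<Rightarrow> 'w::ab_group_add \<Rightarrow> 'w) \<Rightarrow> ('v list \<Rightarrow> 'w) \<Rightarrow> ('k, 'v) tensor \<Rightarrow> 'w" where
  "tensor_lift s f t = linear_extension s f (tensor_rep t)"

definition tensor_lift_tensor ::
  "('k::field \<Rightarrow> 'w::ab_group_add \<Rightarrow> 'w) \<Rightarrow> ('v list \<Rightarrow> ('k, 'w) tensor) \<Rightarrow> ('k, 'v) tensor
    \<Rightarrow> ('k, 'w) tensor" where
  "tensor_lift_tensor s f t =
     tensor_class s (linear_extension formal_scale (\<lambda>xs. tensor_rep (f xs)) (tensor_rep t))"

text \<open>
  Multilinear maps do induce maps on classes: the two lifts can be computed on any representative.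
\<close>
lemma lookup_formal_scale [simp]: "Poly_Mapping.lookup (formal_scale c p) x = c * Poly_Mapping.lookup p x"
  by (auto simp: formal_scale_def Poly_Mapping.map.rep_eq when_def)

interpretation formal: vector_space "formal_scale :: 'k::field \<Rightarrow> ('k, 'v) formal \<Rightarrow> ('k, 'v) formal"
  by unfold_locales (auto intro!: poly_mapping_eqI simp: lookup_add algebra_simps)

lemma linear_extension_superset:
  assumes "vector_space s" "finite A" "Poly_Mapping.keys p \<subseteq> A"
  shows "linear_extension s f p = (\<Sum>xs\<in>A. s (Poly_Mapping.lookup p xs) (f xs))"
proof -
  interpret vector_space s by fact
  show ?thesis unfolding linear_extension_def
    by (rule sum.mono_neutral_left) (use assms in \<open>auto simp: in_keys_iff\<close>)
qed

lemma linear_linear_extension: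
  assumes "vector_space s"
  shows "Vector_Spaces.linear formal_scale s (linear_extension s f)"
proof -
  interpret W: vector_space s by fact
  show ?thesis
  proof (unfold_locales)
    fix p q :: "('a,'c) formal"
    let ?A = "Poly_Mapping.keys p \<union> Poly_Mapping.keys q"
    have "Poly_Mapping.keys (p+q) \<subseteq> ?A" by (rule Poly_Mapping.keys_add)
    then show "linear_extension s f (p + q) = linear_extension s f p + linear_extension s f q"
      by (simp add: linear_extension_superset[OF assms, of ?A] lookup_add W.scale_left_distrib sum.distrib)
  next
    fix c and p :: "('a,'c) formal"
    have "Poly_Mapping.keys (formal_scale c p) \<subseteq> Poly_Mapping.keys p" by (auto simp: in_keys_iff)
    then show "linear_extension s f (formal_scale c p) = s c (linear_extension s f p)"
      by (simp add: linear_extension_superset[OF assms, of "Poly_Mapping.keys p"] W.scale_sum_right)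
  qed
qed

lemma linear_extension_single: assumes "vector_space s" shows "linear_extension s f (Poly_Mapping.single xs 1) = f xs"
proof -
  interpret W: vector_space s by fact
  show ?thesis by (simp add: linear_extension_def)
qed

lemma tensor_rep_tensor_class: "tensor_rep (tensor_class s p) - p \<in> formal.span (multilinear_relations s)"
  unfolding tensor_rep_def tensor_class_def by (rule someI2[of _ p]) (auto simp: formal.span_zero)

lemma tensor_class_eq_iff: "tensor_class s p = tensor_class s q \<longleftrightarrow> p - q \<in> formal.span (multilinear_relations s)"
proof
  assume "tensor_class s p = tensor_class s q"
  moreover have "p \<in> tensor_class s p" by (simp add: tensor_class_def formal.span_zero)
  ultimately show "p - q \<in> formal.span (multilinear_relations s)" by (simp add: tensor_class_def)
next
  assume *: "p - q \<in> formal.span (multilinear_relations s)"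
  { fix r have "r - p \<in> formal.span (multilinear_relations s) \<longleftrightarrow> (p - q) + (r - p) \<in> formal.span (multilinear_relations s)"
      using formal.span_add_eq[OF *] by blast }
  then show "tensor_class s p = tensor_class s q" by (auto simp: tensor_class_def)
qed

lemma tensor_lift_tensor_class:
  assumes "vector_space s'"
    and add: "\<And>xs a b ys. f (xs @ (a+b) # ys) = f (xs @ a # ys) + f (xs @ b # ys)"
    and sc: "\<And>xs c a ys. f (xs @ s c a # ys) = s' c (f (xs @ a # ys))"
  shows "tensor_lift s' f (tensor_class s p) = linear_extension s' f p"
proof -
  interpret L: Vector_Spaces.linear formal_scale s' "linear_extension s' f" by (rule linear_linear_extension) fact
  have "multilinear_relations s \<subseteq> {x. linear_extension s' f x = 0}"
    by (auto simp: multilinear_relations_def L.diff L.scale linear_extension_single[OF assms(1)] add sc)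
  moreover have "formal.subspace {x. linear_extension s' f x = 0}"
    by (auto simp: formal.subspace_def L.add L.scale L.zero)
  ultimately have "formal.span (multilinear_relations s) \<subseteq> {x. linear_extension s' f x = 0}"
    by (rule formal.span_minimal)
  with tensor_rep_tensor_class[of s p] have "linear_extension s' f (tensor_rep (tensor_class s p) - p) = 0" by blast
  then show ?thesis by (simp add: tensor_lift_def L.diff)
qed

lemma tensor_class_tensor_rep: "tensor_class s (tensor_rep (tensor_class s p)) = tensor_class s p"
  using tensor_rep_tensor_class tensor_class_eq_iff by metis

lemma tensor_lift_tensor_tensor_class:
  fixes s' :: "'k::field \<Rightarrow> 'w::ab_group_add \<Rightarrow> 'w" and s :: "'k \<Rightarrow> 'v::ab_group_add \<Rightarrow> 'v"
  assumes r: "\<And>xs. f xs \<in> range (tensor_class s')"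
    and add: "\<And>xs a b ys. f (xs @ (a+b) # ys) = tensor_add s' (f (xs @ a # ys)) (f (xs @ b # ys))"
    and sc: "\<And>xs c a ys. f (xs @ s c a # ys) = tensor_scale s' c (f (xs @ a # ys))"
  shows "tensor_lift_tensor s' f (tensor_class s p) = tensor_class s' (linear_extension formal_scale (\<lambda>xs. tensor_rep (f xs)) p)"
proof -
  let ?N = "formal.span (multilinear_relations s')"
  let ?L = "linear_extension formal_scale (\<lambda>xs. tensor_rep (f xs))"
  interpret L: Vector_Spaces.linear formal_scale formal_scale ?L by (rule linear_linear_extension) unfold_locales
  have a: "tensor_rep (f (xs @ (a+b) # ys)) - tensor_rep (f (xs @ a # ys)) - tensor_rep (f (xs @ b # ys)) \<in> ?N" for xs a b ys
    using tensor_rep_tensor_class[of s' "tensor_rep (f (xs @ a # ys)) + tensor_rep (f (xs @ b # ys))"]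
    unfolding add tensor_add_def by (simp add: algebra_simps)
  have b: "tensor_rep (f (xs @ s c a # ys)) - formal_scale c (tensor_rep (f (xs @ a # ys))) \<in> ?N" for xs a c ys
    using tensor_rep_tensor_class[of s' "formal_scale c (tensor_rep (f (xs @ a # ys)))"]
    unfolding sc tensor_scale_def by (simp add: algebra_simps)
  have "multilinear_relations s \<subseteq> {x. ?L x \<in> ?N}"
    using a b by (auto simp: multilinear_relations_def L.diff L.scale linear_extension_single[OF formal.vector_space_axioms])
  moreover have "formal.subspace {x. ?L x \<in> ?N}"
    by (auto simp: formal.subspace_def L.add L.scale L.zero formal.span_add formal.span_scale formal.span_zero)
  ultimately have "formal.span (multilinear_relations s) \<subseteq> {x. ?L x \<in> ?N}"
    by (rule formal.span_minimal)
  with tensor_rep_tensor_class[of s p] have "?L (tensor_rep (tensor_class s p) - p) \<in> ?N" by blast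
  then show ?thesis by (simp add: tensor_lift_tensor_def tensor_class_eq_iff L.diff)
qed

lemma tensor_lift_pure_tensor:
  assumes "vector_space s'"
    and "\<And>xs a b ys. f (xs @ (a+b) # ys) = f (xs @ a # ys) + f (xs @ b # ys)"
    and "\<And>xs c a ys. f (xs @ s c a # ys) = s' c (f (xs @ a # ys))"
  shows "tensor_lift s' f (pure_tensor s xs) = f xs"
  unfolding pure_tensor_def
  using tensor_lift_tensor_class[of s' f s, OF assms] linear_extension_single[OF assms(1)] by simp

lemma tensor_lift_tensor_pure_tensor:
  fixes s' :: "'k::field \<Rightarrow> 'w::ab_group_add \<Rightarrow> 'w" and s :: "'k \<Rightarrow> 'v::ab_group_add \<Rightarrow> 'v"
  assumes "\<And>xs. f xs \<in> range (tensor_class s')"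
    and "\<And>xs a b ys. f (xs @ (a+b) # ys) = tensor_add s' (f (xs @ a # ys)) (f (xs @ b # ys))"
    and "\<And>xs c a ys. f (xs @ s c a # ys) = tensor_scale s' c (f (xs @ a # ys))"
  shows "tensor_lift_tensor s' f (pure_tensor s xs) = f xs"
proof -
  from assms(1)[of xs] obtain p where "f xs = tensor_class s' p" by blast
  then show ?thesis
    unfolding pure_tensor_def
    using tensor_lift_tensor_tensor_class[of f s' s, OF assms]
      linear_extension_single[OF formal.vector_space_axioms] tensor_class_tensor_rep
    by metis
qed

definition tensor_prod ::
  "('k::field \<Rightarrow> 'v::ab_group_add \<Rightarrow> 'v) \<Rightarrow> ('k, 'v) tensor \<Rightarrow> ('k, 'v) tensor \<Rightarrow> ('k, 'v) tensor"
  where "tensor_prod s t u =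
     tensor_lift_tensor s (\<lambda>xs. tensor_lift_tensor s (\<lambda>ys. pure_tensor s (xs @ ys)) u) t"

definition componentwise_mult ::
  "('k::field \<Rightarrow> 'v::ab_group_add \<Rightarrow> 'v) \<Rightarrow> ('v \<Rightarrow> 'v \<Rightarrow> 'v) \<Rightarrow>
    ('k, 'v) tensor \<Rightarrow> ('k, 'v) tensor \<Rightarrow> ('k, 'v) tensor"
  where "componentwise_mult s m t u =
     tensor_lift_tensor s (\<lambda>xs. tensor_lift_tensor s
       (\<lambda>ys. if length xs = length ys then pure_tensor s (map2 m xs ys) else tensor_zero s) u) t"

text \<open>The \<open>n\<close>-fold tensor power of a linear map, for all \<open>n\<close> at once.\<close>

definition tensor_power_map ::
  "('k::field \<Rightarrow> 'w::ab_group_add \<Rightarrow> 'w) \<Rightarrow> ('v \<Rightarrow> 'w) \<Rightarrow> ('k, 'v) tensor \<Rightarrow> ('k, 'w) tensor" where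
  "tensor_power_map s g = tensor_lift_tensor s (\<lambda>xs. pure_tensor s (map g xs))"

text \<open>The map induced on the second tensor power by a bilinear map; zero in all other degrees.\<close>

definition tensor2_lift ::
  "('k::field \<Rightarrow> 'w::ab_group_add \<Rightarrow> 'w) \<Rightarrow> ('v \<Rightarrow> 'v \<Rightarrow> 'w) \<Rightarrow> ('k, 'v) tensor \<Rightarrow> 'w" where
  "tensor2_lift s f = tensor_lift s (\<lambda>xs. case xs of [x, y] \<Rightarrow> f x y | _ \<Rightarrow> 0)"

definition tensor2_lift_tensor ::
  "('k::field \<Rightarrow> 'v::ab_group_add \<Rightarrow> 'v) \<Rightarrow> ('v \<Rightarrow> 'v \<Rightarrow> ('k, 'v) tensor) \<Rightarrow> ('k, 'v) tensor
    \<Rightarrow> ('k, 'v) tensor" where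
  "tensor2_lift_tensor s f =
     tensor_lift_tensor s (\<lambda>xs. case xs of [x, y] \<Rightarrow> f x y | _ \<Rightarrow> tensor_zero s)"


section \<open>Algebras, coalgebras, bialgebras and weak bialgebras\<close>

text \<open>
  A linear map from the second tensor power of \<open>'v\<close> to \<open>'v\<close> is given by the corresponding
  bilinear map \<open>m\<close>.
\<close>

locale unital_assoc_algebra = vector_space s
  for s :: "'k::field \<Rightarrow> 'v::ab_group_add \<Rightarrow> 'v" +
  fixes m :: "'v \<Rightarrow> 'v \<Rightarrow> 'v" and \<eta> :: "'k \<Rightarrow> 'v"
  assumes mult_linear_left: "\<And>y. Vector_Spaces.linear s s (\<lambda>x. m x y)"
    and mult_linear_right: "\<And>x. Vector_Spaces.linear s s (\<lambda>y. m x y)"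
    and unit_linear: "Vector_Spaces.linear (*) s \<eta>"
    and mult_assoc: "\<And>x y z. m (m x y) z = m x (m y z)"
    and mult_unit_left: "\<And>x. m (\<eta> 1) x = x"
    and mult_unit_right: "\<And>x. m x (\<eta> 1) = x"

definition comult_left ::
  "('k::field \<Rightarrow> 'v::ab_group_add \<Rightarrow> 'v) \<Rightarrow> ('v \<Rightarrow> ('k, 'v) tensor) \<Rightarrow> ('k, 'v) tensor
    \<Rightarrow> ('k, 'v) tensor" where  \<comment> \<open>\<open>\<Delta> \<otimes> id\<close>\<close>
  "comult_left s \<Delta> = tensor2_lift_tensor s (\<lambda>x y. tensor_prod s (\<Delta> x) (pure_tensor s [y]))"

definition comult_right ::
  "('k::field \<Rightarrow> 'v::ab_group_add \<Rightarrow> 'v) \<Rightarrow> ('v \<Rightarrow> ('k, 'v) tensor) \<Rightarrow> ('k, 'v) tensor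
    \<Rightarrow> ('k, 'v) tensor" where  \<comment> \<open>\<open>id \<otimes> \<Delta>\<close>\<close>
  "comult_right s \<Delta> = tensor2_lift_tensor s (\<lambda>x y. tensor_prod s (pure_tensor s [x]) (\<Delta> y))"

locale counital_coalgebra = vector_space s
  for s :: "'k::field \<Rightarrow> 'v::ab_group_add \<Rightarrow> 'v" +
  fixes \<Delta> :: "'v \<Rightarrow> ('k, 'v) tensor" and \<epsilon> :: "'v \<Rightarrow> 'k"
  assumes comult_in: "\<And>x. \<Delta> x \<in> tensor_power s 2"
    and comult_add: "\<And>x y. \<Delta> (x + y) = tensor_add s (\<Delta> x) (\<Delta> y)"
    and comult_scale: "\<And>c x. \<Delta> (s c x) = tensor_scale s c (\<Delta> x)"
    and counit_linear: "Vector_Spaces.linear s (*) \<epsilon>"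
    and coassoc: "\<And>x. comult_left s \<Delta> (\<Delta> x) = comult_right s \<Delta> (\<Delta> x)"
    and counit_left: "\<And>x. tensor2_lift s (\<lambda>y z. s (\<epsilon> y) z) (\<Delta> x) = x"
    and counit_right: "\<And>x. tensor2_lift s (\<lambda>y z. s (\<epsilon> z) y) (\<Delta> x) = x"

locale bialgebra = unital_assoc_algebra s m \<eta> + counital_coalgebra s \<Delta> \<epsilon>
  for s :: "'k::field \<Rightarrow> 'v::ab_group_add \<Rightarrow> 'v" and m \<eta> \<Delta> \<epsilon> +
  assumes comult_mult: "\<And>x y. \<Delta> (m x y) = componentwise_mult s m (\<Delta> x) (\<Delta> y)"
    and comult_unit: "\<Delta> (\<eta> 1) = pure_tensor s [\<eta> 1, \<eta> 1]"
    and counit_mult: "\<And>x y. \<epsilon> (m x y) = \<epsilon> x * \<epsilon> y"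
    and counit_unit: "\<epsilon> (\<eta> 1) = 1"

locale weak_bialgebra = unital_assoc_algebra s m \<eta> + counital_coalgebra s \<Delta> \<epsilon>
  for s :: "'k::field \<Rightarrow> 'v::ab_group_add \<Rightarrow> 'v" and m \<eta> \<Delta> \<epsilon> +
  assumes weak_comult_mult: "\<And>x y. \<Delta> (m x y) = componentwise_mult s m (\<Delta> x) (\<Delta> y)"
    and weak_comult_unit_left: "comult_left s \<Delta> (\<Delta> (\<eta> 1)) =
      componentwise_mult s m
        (tensor_prod s (\<Delta> (\<eta> 1)) (pure_tensor s [\<eta> 1]))
        (tensor_prod s (pure_tensor s [\<eta> 1]) (\<Delta> (\<eta> 1)))"
    and weak_comult_unit_right: "comult_left s \<Delta> (\<Delta> (\<eta> 1)) =
      componentwise_mult s m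
        (tensor_prod s (pure_tensor s [\<eta> 1]) (\<Delta> (\<eta> 1)))
        (tensor_prod s (\<Delta> (\<eta> 1)) (pure_tensor s [\<eta> 1]))"
    and weak_counit_mult: "\<And>x y z. \<epsilon> (m (m x y) z) =
      tensor2_lift (*) (\<lambda>u v. \<epsilon> (m x u) * \<epsilon> (m v z)) (\<Delta> y)"


section \<open>Adjoining a unit to a bialgebra\<close>

text \<open>
  The pair \<open>(x, a)\<close> stands for \<open>x + a e\<^sub>1\<close>, so that \<open>e\<^sub>1 = (0, 1)\<close>, and \<open>x\<close> in the
  original bialgebra is identified with \<open>(x, 0)\<close>.
\<close>

definition adjoin_scale ::
  "('k::field \<Rightarrow> 'v::ab_group_add \<Rightarrow> 'v) \<Rightarrow> 'k \<Rightarrow> 'v \<times> 'k \<Rightarrow> 'v \<times> 'k" where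
  "adjoin_scale s c = (\<lambda>(x, a). (s c x, c * a))"

definition adjoin_mult ::
  "('k::field \<Rightarrow> 'v::ab_group_add \<Rightarrow> 'v) \<Rightarrow> ('v \<Rightarrow> 'v \<Rightarrow> 'v) \<Rightarrow> 'v \<times> 'k \<Rightarrow> 'v \<times> 'k \<Rightarrow> 'v \<times> 'k" where
  "adjoin_mult s m = (\<lambda>(x, a) (y, b). (m x y + s b x + s a y, a * b))"

definition adjoin_unit :: "'k::field \<Rightarrow> 'v::ab_group_add \<times> 'k" where
  "adjoin_unit c = (0, c)"

text \<open>The linear extensions of \<open>\<Delta>\<close> and \<open>\<epsilon>\<close> with the prescribed values at \<open>e\<^sub>1\<close>.\<close>

definition adjoin_comult ::
  "('k::field \<Rightarrow> 'v::ab_group_add \<Rightarrow> 'v) \<Rightarrow> ('k \<Rightarrow> 'v) \<Rightarrow> ('v \<Rightarrow> ('k, 'v) tensor)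
    \<Rightarrow> 'v \<times> 'k \<Rightarrow> ('k, 'v \<times> 'k) tensor" where
  "adjoin_comult s \<eta> \<Delta> = (\<lambda>(x, a).
     let s' = adjoin_scale s; e\<^sub>1 = (0, 1); e\<^sub>2 = (\<eta> 1, 0) in
     tensor_add s'
       (tensor_power_map s' (\<lambda>y. (y, 0)) (\<Delta> x))
       (tensor_scale s' a
         (tensor_add s' (pure_tensor s' [e\<^sub>1 - e\<^sub>2, e\<^sub>1 - e\<^sub>2]) (pure_tensor s' [e\<^sub>2, e\<^sub>2]))))"

definition adjoin_counit :: "('v \<Rightarrow> 'k::field) \<Rightarrow> 'v \<times> 'k \<Rightarrow> 'k" where
  "adjoin_counit \<epsilon> = (\<lambda>(x, a). \<epsilon> x + a * 2)"

end

theory Submission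
  imports Defs
begin

text \<open>
  Put \<open>f = e\<^sub>1 - e\<^sub>2\<close>. Since \<open>e\<^sub>2\<close> is the unit of \<open>B\<close>, the element \<open>f\<close> is an
  idempotent that annihilates \<open>B\<close> on both sides, and \<open>e\<^sub>1 = e\<^sub>2 + f\<close>. As
  \<open>\<Delta>(e\<^sub>2) = e\<^sub>2 \<otimes> e\<^sub>2\<close> and \<open>\<epsilon>(e\<^sub>2) = 1\<close>, the prescribed values at \<open>e\<^sub>1\<close> say precisely
  that \<open>\<Delta>(f) = f \<otimes> f\<close> and \<open>\<epsilon>(f) = 1\<close>. So the enlarged space is the direct sum of the
  bialgebra \<open>B\<close> and the one-dimensional bialgebra spanned by \<open>f\<close>, both as an algebra and as a
  coalgebra. A direct sum of two bialgebras is a coalgebra and a unital algebra; its comultiplication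
  is multiplicative because products of tensors from different summands vanish; but it fails to
  preserve the unit, whose image is \<open>e\<^sub>2 \<otimes> e\<^sub>2 + f \<otimes> f\<close>. The weak axioms survive:
  both products in the unit axiom equal \<open>e\<^sub>2 \<otimes> e\<^sub>2 \<otimes> e\<^sub>2 + f \<otimes> f \<otimes> f\<close>, and in the
  counit axiom both sides are the sum of the two products of counits.

  In coordinates, every element is \<open>combine x a = x + a f\<close> for unique \<open>x\<close> in \<open>B\<close> and a
  scalar \<open>a\<close>, and \<open>mult_combine\<close>, \<open>comult_combine\<close> and \<open>counit_combine\<close> express the
  direct sum decomposition. What happens on the summand \<open>B\<close> is transported along the linear map
  that the inclusion \<open>B \<rightarrow> B \<oplus> K f\<close> induces on tensors. This map commutes with all constructions
  that occur in the axioms (\<open>tensor_power_map_prod\<close>, \<open>tensor_power_map_componentwise_mult\<close>,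
  \<open>comult_left_power_map\<close>, \<open>comult_right_power_map\<close>, \<open>tensor2_lift_natural\<close>).
  Each of these commutation rules, and the orthogonality of the two summands, is an equation between
  linear maps on tensors, so that it suffices to compare them on pure tensors
  (\<open>tensor_linear_eq\<close>, \<open>tensor_linear_eq_on_power\<close>).
\<close>


section \<open>Tensors as a vector space\<close>

text \<open>
  The carrier of the tensor algebra. Addition and scaling of tensors choose representatives, so the
  laws of a vector space are only available for sets of formal sums that are classes.
\<close>
definition tensors ::
  "('k::field \<Rightarrow> 'v::ab_group_add \<Rightarrow> 'v) \<Rightarrow> ('k, 'v) tensor set" where
  "tensors s = range (tensor_class s)"

lemma tensor_class_in_tensors [simp]: "tensor_class s p \<in> tensors s"
  by (simp add: tensors_def)

lemma tensorsE [elim?]: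
  assumes "t \<in> tensors s"
  obtains p where "t = tensor_class s p"
  using assms by (auto simp: tensors_def)

lemma tensor_add_class:
  "tensor_add s (tensor_class s p) (tensor_class s q) = tensor_class s (p + q)"
proof -
  have "(tensor_rep (tensor_class s p) - p) + (tensor_rep (tensor_class s q) - q)
      \<in> formal.span (multilinear_relations s)"
    by (intro formal.span_add tensor_rep_tensor_class)
  then show ?thesis
    by (simp add: tensor_add_def tensor_class_eq_iff algebra_simps)
qed

lemma tensor_scale_class:
  "tensor_scale s c (tensor_class s p) = tensor_class s (formal_scale c p)"
proof -
  have "formal_scale c (tensor_rep (tensor_class s p) - p) \<in> formal.span (multilinear_relations s)"
    by (intro formal.span_scale tensor_rep_tensor_class)
  then show ?thesis
    by (simp add: tensor_scale_def tensor_class_eq_iff formal.scale_right_diff_distrib)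
qed

lemma tensor_closed [simp, intro]:
  "tensor_add s t u \<in> tensors s" "tensor_scale s c t \<in> tensors s"
  "tensor_zero s \<in> tensors s" "pure_tensor s xs \<in> tensors s"
  by (auto simp: tensor_add_def tensor_scale_def tensor_zero_def pure_tensor_def)

lemma tensor_power_subset: "t \<in> tensor_power s n \<Longrightarrow> t \<in> tensors s"
  by (auto simp: tensor_power_def)

lemma tensor_add_commute: "tensor_add s t u = tensor_add s u t"
  by (simp add: tensor_add_def add.commute)

lemma tensor_add_assoc:
  assumes "t \<in> tensors s" "u \<in> tensors s" "v \<in> tensors s"
  shows "tensor_add s (tensor_add s t u) v = tensor_add s t (tensor_add s u v)"
  using assms by (auto simp: tensors_def tensor_add_class add.assoc)

lemma tensor_add_swap:
  assumes "t \<in> tensors s" "t' \<in> tensors s" "u \<in> tensors s" "u' \<in> tensors s"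
  shows "tensor_add s (tensor_add s t t') (tensor_add s u u')
       = tensor_add s (tensor_add s t u) (tensor_add s t' u')"
  using assms by (auto simp: tensors_def tensor_add_class add_ac)

lemma tensor_add_zero:
  assumes "t \<in> tensors s"
  shows "tensor_add s t (tensor_zero s) = t" "tensor_add s (tensor_zero s) t = t"
  using assms by (auto simp: tensors_def tensor_add_class tensor_zero_def)

lemma tensor_scale_add:
  assumes "t \<in> tensors s" "u \<in> tensors s"
  shows "tensor_scale s c (tensor_add s t u) = tensor_add s (tensor_scale s c t) (tensor_scale s c u)"
  using assms by (auto simp: tensors_def tensor_add_class tensor_scale_class formal.scale_right_distrib)

lemma tensor_scale_left_add:
  assumes "t \<in> tensors s"
  shows "tensor_scale s (a + b) t = tensor_add s (tensor_scale s a t) (tensor_scale s b t)"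
  using assms by (auto simp: tensors_def tensor_add_class tensor_scale_class formal.scale_left_distrib)

lemma tensor_scale_scale:
  assumes "t \<in> tensors s"
  shows "tensor_scale s a (tensor_scale s b t) = tensor_scale s (a * b) t"
  using assms by (auto simp: tensors_def tensor_scale_class)

lemma tensor_scale_simps:
  assumes "t \<in> tensors s"
  shows "tensor_scale s 1 t = t" "tensor_scale s 0 t = tensor_zero s"
  using assms by (auto simp: tensors_def tensor_scale_class tensor_zero_def)

lemma tensor_scale_zero: "tensor_scale s c (tensor_zero s) = tensor_zero s"
  by (auto simp: tensor_scale_class tensor_zero_def)

text \<open>
  Every class is a linear combination of pure tensors whose lists occur in a chosen representative.
  The condition \<open>Q\<close> on these lists lets the same argument serve one fixed degree and all
  degrees together.
\<close>
lemma tensor_class_induct: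
  assumes p: "\<forall>xs \<in> Poly_Mapping.keys p. Q xs"
    and zero: "P (tensor_zero s)"
    and add: "\<And>t u. t \<in> tensors s \<Longrightarrow> u \<in> tensors s \<Longrightarrow> P t \<Longrightarrow> P u \<Longrightarrow> P (tensor_add s t u)"
    and pure: "\<And>c xs. Q xs \<Longrightarrow> P (tensor_scale s c (pure_tensor s xs))"
  shows "P (tensor_class s p)"
proof -
  let ?sum = "\<lambda>A. \<Sum>xs\<in>A. formal_scale (Poly_Mapping.lookup p xs) (Poly_Mapping.single xs 1)"
  have "?sum (Poly_Mapping.keys p) = p"
  proof (rule poly_mapping_eqI)
    fix ys
    show "Poly_Mapping.lookup (?sum (Poly_Mapping.keys p)) ys = Poly_Mapping.lookup p ys"
      by (simp add: lookup_sum lookup_single when_def sum.delta in_keys_iff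
          if_distrib[of "(*) _"] cong: if_cong)
  qed
  moreover have "P (tensor_class s (?sum A))" if "finite A" "A \<subseteq> Poly_Mapping.keys p" for A
    using that
  proof (induction A rule: finite_induct)
    case empty
    then show ?case using zero by (simp add: tensor_zero_def)
  next
    case (insert xs A)
    have "P (tensor_scale s (Poly_Mapping.lookup p xs) (pure_tensor s xs))"
      using insert.prems p by (auto intro: pure)
    then have "P (tensor_class s (formal_scale (Poly_Mapping.lookup p xs) (Poly_Mapping.single xs 1)))"
      by (simp add: pure_tensor_def tensor_scale_class)
    with insert have "P (tensor_add s
        (tensor_class s (formal_scale (Poly_Mapping.lookup p xs) (Poly_Mapping.single xs 1)))
        (tensor_class s (?sum A)))"
      by (intro add) auto
    with insert.hyps show ?case by (simp add: tensor_add_class)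
  qed
  ultimately show ?thesis by (metis finite_keys order_refl)
qed

lemma tensor_power_induct [consumes 1, case_names zero add pure]:
  assumes "t \<in> tensor_power s n" "P (tensor_zero s)"
    and "\<And>t u. t \<in> tensors s \<Longrightarrow> u \<in> tensors s \<Longrightarrow> P t \<Longrightarrow> P u \<Longrightarrow> P (tensor_add s t u)"
    and "\<And>c xs. length xs = n \<Longrightarrow> P (tensor_scale s c (pure_tensor s xs))"
  shows "P t"
proof -
  from assms(1) obtain p where "t = tensor_class s p" "\<forall>xs\<in>Poly_Mapping.keys p. length xs = n"
    by (auto simp: tensor_power_def)
  then show ?thesis
    using tensor_class_induct[of p "\<lambda>xs. length xs = n" P s] assms(2-) by blast
qed

lemma tensors_induct [consumes 1, case_names zero add pure]:
  assumes "t \<in> tensors s" "P (tensor_zero s)"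
    and "\<And>t u. t \<in> tensors s \<Longrightarrow> u \<in> tensors s \<Longrightarrow> P t \<Longrightarrow> P u \<Longrightarrow> P (tensor_add s t u)"
    and "\<And>c xs. P (tensor_scale s c (pure_tensor s xs))"
  shows "P t"
proof -
  from assms(1) obtain p where "t = tensor_class s p" by (rule tensorsE)
  then show ?thesis
    using tensor_class_induct[of p "\<lambda>_. True" P s] assms(2-) by blast
qed

lemma tensor_power_closed:
  "t \<in> tensor_power s n \<Longrightarrow> u \<in> tensor_power s n \<Longrightarrow> tensor_add s t u \<in> tensor_power s n"
  "t \<in> tensor_power s n \<Longrightarrow> tensor_scale s c t \<in> tensor_power s n"
  "tensor_zero s \<in> tensor_power s n"
  "length xs = n \<Longrightarrow> pure_tensor s xs \<in> tensor_power s n"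
proof -
  show "tensor_add s t u \<in> tensor_power s n"
    if tu: "t \<in> tensor_power s n" "u \<in> tensor_power s n"
  proof -
    from tu obtain p q where pq: "t = tensor_class s p" "u = tensor_class s q"
        "\<forall>xs\<in>Poly_Mapping.keys p. length xs = n" "\<forall>xs\<in>Poly_Mapping.keys q. length xs = n"
      by (auto simp: tensor_power_def)
    have "\<forall>xs\<in>Poly_Mapping.keys (p + q). length xs = n"
      using pq Poly_Mapping.keys_add[of p q] by blast
    then show ?thesis using pq by (auto simp: tensor_add_class tensor_power_def)
  qed
  show "tensor_scale s c t \<in> tensor_power s n" if t: "t \<in> tensor_power s n"
  proof -
    from t obtain p where p: "t = tensor_class s p" "\<forall>xs\<in>Poly_Mapping.keys p. length xs = n"
      by (auto simp: tensor_power_def)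
    then have "\<forall>xs\<in>Poly_Mapping.keys (formal_scale c p). length xs = n"
      by (auto simp: in_keys_iff)
    then show ?thesis using p by (auto simp: tensor_scale_class tensor_power_def)
  qed
  show "tensor_zero s \<in> tensor_power s n"
    by (auto simp: tensor_zero_def tensor_power_def)
  show "pure_tensor s xs \<in> tensor_power s n" if "length xs = n"
    using that by (auto simp: pure_tensor_def tensor_power_def split: if_splits)
qed


section \<open>Linear maps into and between spaces of tensors\<close>

text \<open>
  A comultiplication is a linear map of this kind. Its linearity cannot be stated with
  \<open>Vector_Spaces.linear\<close>, because the operations on tensors are group operations only on
  \<open>tensors s'\<close> and not on the whole type.
\<close>
definition linear_to_tensors ::
  "('k::field \<Rightarrow> 'v::ab_group_add \<Rightarrow> 'v) \<Rightarrow> ('k \<Rightarrow> 'w::ab_group_add \<Rightarrow> 'w)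
    \<Rightarrow> ('v \<Rightarrow> ('k, 'w) tensor) \<Rightarrow> bool" where
  "linear_to_tensors s s' D \<longleftrightarrow>
     (\<forall>x. D x \<in> tensors s') \<and>
     (\<forall>x y. D (x + y) = tensor_add s' (D x) (D y)) \<and>
     (\<forall>c x. D (s c x) = tensor_scale s' c (D x))"

text \<open>
  Multilinearity in every degree at once, as in the quotient that defines tensors. The empty list has
  no argument in which to be linear, so that its value is required to be a tensor separately.
\<close>
definition multilinear_to_tensors ::
  "('k::field \<Rightarrow> 'v::ab_group_add \<Rightarrow> 'v) \<Rightarrow> ('k \<Rightarrow> 'w::ab_group_add \<Rightarrow> 'w)
    \<Rightarrow> ('v list \<Rightarrow> ('k, 'w) tensor) \<Rightarrow> bool" where
  "multilinear_to_tensors s s' f \<longleftrightarrow>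
     f [] \<in> tensors s' \<and> (\<forall>xs ys. linear_to_tensors s s' (\<lambda>a. f (xs @ a # ys)))"

definition tensor_linear ::
  "('k::field \<Rightarrow> 'v::ab_group_add \<Rightarrow> 'v) \<Rightarrow> ('k \<Rightarrow> 'w::ab_group_add \<Rightarrow> 'w)
    \<Rightarrow> (('k, 'v) tensor \<Rightarrow> ('k, 'w) tensor) \<Rightarrow> bool" where
  "tensor_linear s s' F \<longleftrightarrow>
     (\<forall>t \<in> tensors s. F t \<in> tensors s') \<and>
     (\<forall>t \<in> tensors s. \<forall>u \<in> tensors s. F (tensor_add s t u) = tensor_add s' (F t) (F u)) \<and>
     (\<forall>c. \<forall>t \<in> tensors s. F (tensor_scale s c t) = tensor_scale s' c (F t))"

lemma linear_to_tensorsI: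
  assumes "\<And>x. D x \<in> tensors s'" "\<And>x y. D (x + y) = tensor_add s' (D x) (D y)"
    and "\<And>c x. D (s c x) = tensor_scale s' c (D x)"
  shows "linear_to_tensors s s' D"
  using assms unfolding linear_to_tensors_def by blast

lemma linear_to_tensorsD:
  assumes "linear_to_tensors s s' D"
  shows "D x \<in> tensors s'" "D (x + y) = tensor_add s' (D x) (D y)"
    "D (s c x) = tensor_scale s' c (D x)"
  using assms unfolding linear_to_tensors_def by blast+

lemma tensor_linearD:
  assumes "tensor_linear s s' F"
  shows "t \<in> tensors s \<Longrightarrow> F t \<in> tensors s'"
    "t \<in> tensors s \<Longrightarrow> u \<in> tensors s \<Longrightarrow> F (tensor_add s t u) = tensor_add s' (F t) (F u)"
    "t \<in> tensors s \<Longrightarrow> F (tensor_scale s c t) = tensor_scale s' c (F t)"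
  using assms unfolding tensor_linear_def by blast+

lemma tensor_linear_zero:
  assumes "tensor_linear s s' F"
  shows "F (tensor_zero s) = tensor_zero s'"
proof -
  have "F (tensor_scale s 0 (tensor_zero s)) = tensor_scale s' 0 (F (tensor_zero s))"
    using assms by (auto simp: tensor_linearD)
  then show ?thesis
    using tensor_linearD(1)[OF assms, of "tensor_zero s"] by (simp add: tensor_scale_simps)
qed

lemma linear_to_tensors_zero:
  assumes "linear_to_tensors s s' D" "vector_space s"
  shows "D 0 = tensor_zero s'"
proof -
  interpret vector_space s by fact
  show ?thesis
    using linear_to_tensorsD(1)[OF assms(1), of 0] linear_to_tensorsD(3)[OF assms(1), of 0 0]
    by (simp add: tensor_scale_simps)
qed

lemma tensor_linear_compose:
  "tensor_linear s s' F \<Longrightarrow> tensor_linear s' s'' G \<Longrightarrow> tensor_linear s s'' (\<lambda>t. G (F t))"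
  by (simp add: tensor_linear_def)

lemma tensor_linear_zero_map: "tensor_linear s s' (\<lambda>t. tensor_zero s')"
  by (simp add: tensor_linear_def tensor_add_zero tensor_scale_zero)

lemma tensor_linear_add:
  "tensor_linear s s' F \<Longrightarrow> tensor_linear s s' G \<Longrightarrow> tensor_linear s s' (\<lambda>t. tensor_add s' (F t) (G t))"
  by (simp add: tensor_linear_def tensor_add_swap tensor_scale_add)

lemma tensor_linear_scale:
  "tensor_linear s s' F \<Longrightarrow> tensor_linear s s' (\<lambda>t. tensor_scale s' c (F t))"
  by (simp add: tensor_linear_def tensor_scale_add tensor_scale_scale mult.commute)

lemma linear_to_tensors_compose:
  "linear_to_tensors s s' D \<Longrightarrow> tensor_linear s' s'' F \<Longrightarrow> linear_to_tensors s s'' (\<lambda>x. F (D x))"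
  by (simp add: linear_to_tensors_def tensor_linear_def)

lemma linear_to_tensors_precompose:
  "Vector_Spaces.linear s s' g \<Longrightarrow> linear_to_tensors s' s'' D \<Longrightarrow> linear_to_tensors s s'' (\<lambda>x. D (g x))"
  by (simp add: linear_to_tensors_def Vector_Spaces.linear_iff)

lemma linear_to_tensors_zero_map: "linear_to_tensors s s' (\<lambda>x. tensor_zero s')"
  by (simp add: linear_to_tensors_def tensor_add_zero tensor_scale_zero)

text \<open>
  The principle by which all identities between maps on tensors are proved below: only pure tensors of
  the relevant degree have to be compared.
\<close>
lemma tensor_linear_eq_on_power:
  assumes F: "tensor_linear s s' F" and G: "tensor_linear s s' G"
    and pure: "\<And>xs. length xs = n \<Longrightarrow> F (pure_tensor s xs) = G (pure_tensor s xs)"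
    and "t \<in> tensor_power s n"
  shows "F t = G t"
  using assms(4)
  by (induction rule: tensor_power_induct)
    (simp_all add: tensor_linearD[OF F] tensor_linearD[OF G]
      tensor_linear_zero[OF F] tensor_linear_zero[OF G] pure)

lemma tensor_linear_eq:
  assumes F: "tensor_linear s s' F" and G: "tensor_linear s s' G"
    and pure: "\<And>xs. F (pure_tensor s xs) = G (pure_tensor s xs)"
    and "t \<in> tensors s"
  shows "F t = G t"
  using assms(4)
  by (induction rule: tensors_induct)
    (simp_all add: tensor_linearD[OF F] tensor_linearD[OF G]
      tensor_linear_zero[OF F] tensor_linear_zero[OF G] pure)

lemma tensor_linear_power:
  assumes F: "tensor_linear s s' F"
    and pure: "\<And>xs. length xs = n \<Longrightarrow> F (pure_tensor s xs) \<in> tensor_power s' k"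
    and "t \<in> tensor_power s n"
  shows "F t \<in> tensor_power s' k"
  using assms(3)
  by (induction rule: tensor_power_induct)
    (simp_all add: tensor_linearD[OF F] tensor_linear_zero[OF F] tensor_power_closed pure)

lemma multilinear_to_tensorsI:
  assumes "f [] \<in> tensors s'" "\<And>xs ys. linear_to_tensors s s' (\<lambda>a. f (xs @ a # ys))"
  shows "multilinear_to_tensors s s' f"
  using assms by (simp add: multilinear_to_tensors_def)

lemma multilinear_to_tensorsD:
  assumes "multilinear_to_tensors s s' f"
  shows "linear_to_tensors s s' (\<lambda>a. f (xs @ a # ys))" "f xs \<in> tensors s'"
proof -
  show "linear_to_tensors s s' (\<lambda>a. f (xs @ a # ys))" for xs ys
    using assms by (simp add: multilinear_to_tensors_def)
  from linear_to_tensorsD(1)[OF this, of "[]"] assms show "f xs \<in> tensors s'"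
    by (cases xs) (auto simp: multilinear_to_tensors_def)
qed

lemma multilinear_pure_tensor: "multilinear_to_tensors s s (pure_tensor s)"
proof (intro multilinear_to_tensorsI linear_to_tensorsI)
  fix xs ys and a b :: 'b and c
  have "Poly_Mapping.single (xs @ (a + b) # ys) 1 - Poly_Mapping.single (xs @ a # ys) 1
        - Poly_Mapping.single (xs @ b # ys) 1 \<in> multilinear_relations s"
    unfolding multilinear_relations_def by blast
  from formal.span_base[OF this]
  show "pure_tensor s (xs @ (a + b) # ys)
      = tensor_add s (pure_tensor s (xs @ a # ys)) (pure_tensor s (xs @ b # ys))"
    by (simp add: pure_tensor_def tensor_add_class tensor_class_eq_iff algebra_simps)
  have "Poly_Mapping.single (xs @ s c a # ys) 1
        - formal_scale c (Poly_Mapping.single (xs @ a # ys) 1) \<in> multilinear_relations s"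
    unfolding multilinear_relations_def by blast
  from formal.span_base[OF this]
  show "pure_tensor s (xs @ s c a # ys) = tensor_scale s c (pure_tensor s (xs @ a # ys))"
    by (simp add: pure_tensor_def tensor_scale_class tensor_class_eq_iff)
qed auto

lemma pure_tensor_zero:
  assumes "vector_space s" "0 \<in> set xs"
  shows "pure_tensor s xs = tensor_zero s"
proof -
  from assms(2) obtain us vs where "xs = us @ 0 # vs" by (auto simp: in_set_conv_decomp)
  then show ?thesis
    using linear_to_tensors_zero[OF multilinear_to_tensorsD(1)[OF multilinear_pure_tensor] assms(1)]
    by simp
qed

lemma multilinear_map:
  assumes f: "multilinear_to_tensors s s' f" and g: "Vector_Spaces.linear r s g"
  shows "multilinear_to_tensors r s' (\<lambda>xs. f (map g xs))"
  using linear_to_tensors_precompose[OF g multilinear_to_tensorsD(1)[OF f]]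
    multilinear_to_tensorsD(2)[OF f]
  by (intro multilinear_to_tensorsI) simp_all


section \<open>Universal properties\<close>

text \<open>
  The universal property of the tensor algebra, for multilinear maps with values in tensors.
\<close>
lemma tensor_lift_tensor_linear:
  assumes "multilinear_to_tensors s s' f"
  shows "tensor_linear s s' (tensor_lift_tensor s' f)"
    and "tensor_lift_tensor s' f (pure_tensor s xs) = f xs"
proof -
  note f = multilinear_to_tensorsD[OF assms] linear_to_tensorsD[OF multilinear_to_tensorsD(1)[OF assms]]
  note range = f(2)[unfolded tensors_def]
  note cls = tensor_lift_tensor_tensor_class[of f s' s, OF range f(4) f(5)]
  interpret L: Vector_Spaces.linear formal_scale formal_scale
    "linear_extension formal_scale (\<lambda>xs. tensor_rep (f xs))"
    by (rule linear_linear_extension) unfold_locales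
  show "tensor_linear s s' (tensor_lift_tensor s' f)"
    by (auto simp: tensor_linear_def cls tensor_add_class tensor_scale_class L.add L.scale elim!: tensorsE)
  show "tensor_lift_tensor s' f (pure_tensor s xs) = f xs"
    by (rule tensor_lift_tensor_pure_tensor[of f s' s, OF range f(4) f(5)])
qed

text \<open>
  The lift also depends linearly on the multilinear map. This is what makes an iterated lift
  multilinear in its outer argument.
\<close>
lemma tensor_lift_tensor_add_fun:
  assumes f: "multilinear_to_tensors s s' f" "multilinear_to_tensors s s' g"
    "multilinear_to_tensors s s' h"
    and "\<And>xs. f xs = tensor_add s' (g xs) (h xs)" "t \<in> tensors s"
  shows "tensor_lift_tensor s' f t = tensor_add s' (tensor_lift_tensor s' g t) (tensor_lift_tensor s' h t)"
proof -
  note L = f[THEN tensor_lift_tensor_linear(1)] and P = f[THEN tensor_lift_tensor_linear(2)]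
  show ?thesis
    by (rule tensor_linear_eq[OF L(1) tensor_linear_add[OF L(2,3)] _ assms(5)]) (simp add: P assms(4))
qed

lemma tensor_lift_tensor_scale_fun:
  assumes f: "multilinear_to_tensors s s' f" "multilinear_to_tensors s s' g"
    and "\<And>xs. f xs = tensor_scale s' c (g xs)" "t \<in> tensors s"
  shows "tensor_lift_tensor s' f t = tensor_scale s' c (tensor_lift_tensor s' g t)"
proof -
  note L = f[THEN tensor_lift_tensor_linear(1)] and P = f[THEN tensor_lift_tensor_linear(2)]
  show ?thesis
    by (rule tensor_linear_eq[OF L(1) tensor_linear_scale[OF L(2)] _ assms(4)]) (simp add: P assms(3))
qed

text \<open>
  A map of two lists that is multilinear in each of them induces a bilinear map of two tensors. Both
  the tensor product and the componentwise product arise in this way. Linearity in \<open>u\<close> is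
  clear when \<open>t\<close> is pure, and for other \<open>t\<close> it follows because sums and multiples of
  linear maps are linear.
\<close>
lemma double_lift:
  fixes s :: "'k::field \<Rightarrow> 'v::ab_group_add \<Rightarrow> 'v"
  defines "B \<equiv> \<lambda>g t u. tensor_lift_tensor s (\<lambda>xs. tensor_lift_tensor s (g xs) u) t"
  assumes right: "\<And>xs. multilinear_to_tensors s s (g xs)"
    and left: "\<And>ys. multilinear_to_tensors s s (\<lambda>xs. g xs ys)"
  shows "u \<in> tensors s \<Longrightarrow> tensor_linear s s (\<lambda>t. B g t u)"
    and "t \<in> tensors s \<Longrightarrow> tensor_linear s s (B g t)"
    and "B g (pure_tensor s xs) (pure_tensor s ys) = g xs ys"
proof -
  note r = tensor_lift_tensor_linear[OF right]
  have ml: "multilinear_to_tensors s s (\<lambda>xs. tensor_lift_tensor s (g xs) u)" if u: "u \<in> tensors s" for u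
  proof (intro multilinear_to_tensorsI linear_to_tensorsI)
    fix xs ys and a b :: 'v and c
    show "tensor_lift_tensor s (g []) u \<in> tensors s" "tensor_lift_tensor s (g (xs @ a # ys)) u \<in> tensors s"
      using tensor_linearD(1)[OF r(1) u] by blast+
    note l = linear_to_tensorsD[OF multilinear_to_tensorsD(1)[OF left]]
    show "tensor_lift_tensor s (g (xs @ (a + b) # ys)) u = tensor_add s
        (tensor_lift_tensor s (g (xs @ a # ys)) u) (tensor_lift_tensor s (g (xs @ b # ys)) u)"
      by (rule tensor_lift_tensor_add_fun[OF right right right _ u]) (rule l)
    show "tensor_lift_tensor s (g (xs @ s c a # ys)) u
        = tensor_scale s c (tensor_lift_tensor s (g (xs @ a # ys)) u)"
      by (rule tensor_lift_tensor_scale_fun[OF right right _ u]) (rule l)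
  qed
  note o = tensor_lift_tensor_linear[OF ml]
  show 1: "tensor_linear s s (\<lambda>t. B g t u)" if "u \<in> tensors s" for u
    unfolding B_def using o(1)[OF that] by simp
  have pure_left: "B g (pure_tensor s xs) u = tensor_lift_tensor s (g xs) u" if "u \<in> tensors s" for xs u
    unfolding B_def using o(2)[OF that] by simp
  show "B g (pure_tensor s xs) (pure_tensor s ys) = g xs ys"
    by (simp add: pure_left r(2))
  show "tensor_linear s s (B g t)" if "t \<in> tensors s"
    using that
  proof (induction rule: tensors_induct)
    case zero
    have "B g (tensor_zero s) u = tensor_zero s" if "u \<in> tensors s" for u
      using tensor_linear_zero[OF 1[OF that]] by simp
    with tensor_linear_zero_map[of s s] show ?case
      by (simp add: tensor_linear_def)
  next
    case (add t u)
    have "B g (tensor_add s t u) v = tensor_add s (B g t v) (B g u v)" if "v \<in> tensors s" for v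
      using tensor_linearD(2)[OF 1[OF that]] add by blast
    with tensor_linear_add[OF add.IH] show ?case
      by (simp add: tensor_linear_def)
  next
    case (pure c xs)
    have "B g (tensor_scale s c (pure_tensor s xs)) v = tensor_scale s c (tensor_lift_tensor s (g xs) v)"
      if "v \<in> tensors s" for v
      using tensor_linearD(3)[OF 1[OF that]] that by (simp add: pure_left)
    with tensor_linear_scale[OF r(1)] show ?case
      by (simp add: tensor_linear_def)
  qed
qed

lemma tensor_prod_bilinear:
  shows "u \<in> tensors s \<Longrightarrow> tensor_linear s s (\<lambda>t. tensor_prod s t u)"
    and "t \<in> tensors s \<Longrightarrow> tensor_linear s s (tensor_prod s t)"
    and "tensor_prod s (pure_tensor s xs) (pure_tensor s ys) = pure_tensor s (xs @ ys)"
proof -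
  have r: "multilinear_to_tensors s s (\<lambda>ys. pure_tensor s (xs @ ys))" for xs
    using multilinear_to_tensorsD(1)[OF multilinear_pure_tensor, of s "xs @ zs" zs' for zs zs']
    by (intro multilinear_to_tensorsI) simp_all
  have l: "multilinear_to_tensors s s (\<lambda>xs. pure_tensor s (xs @ ys))" for ys
    using multilinear_to_tensorsD[OF multilinear_pure_tensor]
    by (intro multilinear_to_tensorsI) simp_all
  note * = double_lift[of s "\<lambda>xs ys. pure_tensor s (xs @ ys)", OF r l]
  show "u \<in> tensors s \<Longrightarrow> tensor_linear s s (\<lambda>t. tensor_prod s t u)"
    and "t \<in> tensors s \<Longrightarrow> tensor_linear s s (tensor_prod s t)"
    and "tensor_prod s (pure_tensor s xs) (pure_tensor s ys) = pure_tensor s (xs @ ys)"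
    unfolding tensor_prod_def using * by blast+
qed

definition bilinear_map ::
  "('k::field \<Rightarrow> 'v::ab_group_add \<Rightarrow> 'v) \<Rightarrow> ('k \<Rightarrow> 'w::ab_group_add \<Rightarrow> 'w)
    \<Rightarrow> ('v \<Rightarrow> 'v \<Rightarrow> 'w) \<Rightarrow> bool" where
  "bilinear_map s s' f \<longleftrightarrow>
     (\<forall>y. Vector_Spaces.linear s s' (\<lambda>x. f x y)) \<and> (\<forall>x. Vector_Spaces.linear s s' (f x))"

text \<open>
  Multilinearity in one list while the other is fixed: if the lengths agree, an entry of the first
  list meets exactly one entry of the second, and \<open>m\<close> is linear in it; otherwise the map is zero.
\<close>
lemma componentwise_mult_bilinear:
  assumes m: "bilinear_map s s m"
  shows "u \<in> tensors s \<Longrightarrow> tensor_linear s s (\<lambda>t. componentwise_mult s m t u)"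
    and "t \<in> tensors s \<Longrightarrow> tensor_linear s s (componentwise_mult s m t)"
    and "componentwise_mult s m (pure_tensor s xs) (pure_tensor s ys)
      = (if length xs = length ys then pure_tensor s (map2 m xs ys) else tensor_zero s)"
proof -
  let ?g = "\<lambda>xs ys. if length xs = length ys then pure_tensor s (map2 m xs ys) else tensor_zero s"
  have lin: "Vector_Spaces.linear s s (m x)" "Vector_Spaces.linear s s (\<lambda>x. m x y)" for x y
    using m by (auto simp: bilinear_map_def)
  note pure = multilinear_to_tensorsD(1)[OF multilinear_pure_tensor]
  have split: "\<exists>us b vs. zs = us @ b # vs \<and> length us = length xs \<and> length vs = length ys"
    if "length zs = Suc (length xs + length ys)" for zs xs ys :: "'b list"
    using that
    by (intro exI[of _ "take (length xs) zs"] exI[of _ "zs ! length xs"] exI[of _ "drop (Suc (length xs)) zs"])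
      (simp add: id_take_nth_drop[symmetric])
  have r: "multilinear_to_tensors s s (?g zs)" for zs
  proof (rule multilinear_to_tensorsI)
    fix xs ys :: "'b list"
    show "linear_to_tensors s s (\<lambda>a. ?g zs (xs @ a # ys))"
    proof (cases "length zs = Suc (length xs + length ys)")
      case True
      with split obtain us b vs where "zs = us @ b # vs" "length us = length xs" "length vs = length ys"
        by blast
      then show ?thesis
        using linear_to_tensors_precompose[OF lin(1) pure, of "map2 m us xs" b "map2 m vs ys"]
        by simp
    qed (simp add: linear_to_tensors_zero_map)
  qed simp
  have l: "multilinear_to_tensors s s (\<lambda>xs. ?g xs zs)" for zs
  proof (rule multilinear_to_tensorsI)
    fix xs ys :: "'b list"
    show "linear_to_tensors s s (\<lambda>a. ?g (xs @ a # ys) zs)"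
    proof (cases "length zs = Suc (length xs + length ys)")
      case True
      with split obtain us b vs where "zs = us @ b # vs" "length us = length xs" "length vs = length ys"
        by blast
      then show ?thesis
        using linear_to_tensors_precompose[OF lin(2) pure, of "map2 m xs us" b "map2 m ys vs"]
        by simp
    qed (simp add: linear_to_tensors_zero_map)
  qed simp
  note * = double_lift[of s ?g, OF r l]
  show "u \<in> tensors s \<Longrightarrow> tensor_linear s s (\<lambda>t. componentwise_mult s m t u)"
    and "t \<in> tensors s \<Longrightarrow> tensor_linear s s (componentwise_mult s m t)"
    and "componentwise_mult s m (pure_tensor s xs) (pure_tensor s ys) = ?g xs ys"
    unfolding componentwise_mult_def using * by blast+
qed

lemma tensor_power_map_linear:
  assumes "Vector_Spaces.linear s s' g"
  shows "tensor_linear s s' (tensor_power_map s' g)"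
    and "tensor_power_map s' g (pure_tensor s xs) = pure_tensor s' (map g xs)"
  unfolding tensor_power_map_def
  by (intro tensor_lift_tensor_linear multilinear_map[OF multilinear_pure_tensor assms])+

lemma length_2_cases:
  assumes "length xs = 2"
  obtains x y where "xs = [x, y]"
  using assms by (auto simp: length_Suc_conv numeral_2_eq_2)

text \<open>
  The two slots of a list of length two. In all other degrees the maps that define
  \<open>tensor2_lift\<close> and \<open>tensor2_lift_tensor\<close> vanish, which is trivially multilinear.
\<close>
lemma two_element_split:
  fixes xs ys :: "'v list"
  assumes "length (xs @ (a::'v) # ys) = 2"
  obtains y where "xs = []" "ys = [y]" | x where "xs = [x]" "ys = []"
  using assms that by (cases xs; cases ys) auto

lemma tensor2_lift_tensor_linear:
  fixes s :: "'k::field \<Rightarrow> 'v::ab_group_add \<Rightarrow> 'v"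
  assumes "\<And>y. linear_to_tensors s s (\<lambda>x. f x y)" "\<And>x. linear_to_tensors s s (f x)"
  shows "tensor_linear s s (tensor2_lift_tensor s f)"
    and "tensor2_lift_tensor s f (pure_tensor s [x, y]) = f x y"
proof -
  let ?g = "\<lambda>xs. case xs of [x, y] \<Rightarrow> f x y | _ \<Rightarrow> tensor_zero s"
  have "multilinear_to_tensors s s ?g"
  proof (rule multilinear_to_tensorsI)
    fix xs ys :: "'v list"
    show "linear_to_tensors s s (\<lambda>a. ?g (xs @ a # ys))"
    proof (cases "Suc (length xs + length ys) = 2")
      case True
      then have "length (xs @ undefined # ys) = 2" by simp
      then show ?thesis by (rule two_element_split) (simp_all add: assms)
    next
      case False
      have "?g zs = tensor_zero s" if "length zs \<noteq> 2" for zs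
        using that by (auto split: list.splits)
      with False have "?g (xs @ a # ys) = tensor_zero s" for a by simp
      then show ?thesis by (simp add: linear_to_tensors_zero_map)
    qed
  qed simp
  from tensor_lift_tensor_linear[OF this] tensor_lift_tensor_linear(2)[OF this, of "[x, y]"]
  show "tensor_linear s s (tensor2_lift_tensor s f)"
    "tensor2_lift_tensor s f (pure_tensor s [x, y]) = f x y"
    by (simp_all add: tensor2_lift_tensor_def)
qed

lemma tensor2_lift_linear:
  fixes s :: "'k::field \<Rightarrow> 'v::ab_group_add \<Rightarrow> 'v" and f :: "'v \<Rightarrow> 'v \<Rightarrow> 'w::ab_group_add"
  assumes f: "bilinear_map s s' f"
  shows "t \<in> tensors s \<Longrightarrow> u \<in> tensors s
      \<Longrightarrow> tensor2_lift s' f (tensor_add s t u) = tensor2_lift s' f t + tensor2_lift s' f u"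
    and "t \<in> tensors s \<Longrightarrow> tensor2_lift s' f (tensor_scale s c t) = s' c (tensor2_lift s' f t)"
    and "tensor2_lift s' f (tensor_zero s) = 0"
    and "tensor2_lift s' f (pure_tensor s [x, y]) = f x y"
proof -
  let ?g = "\<lambda>xs. case xs of [x, y] \<Rightarrow> f x y | _ \<Rightarrow> 0"
  have lin: "Vector_Spaces.linear s s' (f x)" "Vector_Spaces.linear s s' (\<lambda>x. f x y)" for x y
    using f by (auto simp: bilinear_map_def)
  interpret W: vector_space s' using lin(1) by (auto simp: Vector_Spaces.linear_iff)
  note lin = lin[unfolded Vector_Spaces.linear_iff]
  have g: "?g (xs @ (a + b) # ys) = ?g (xs @ a # ys) + ?g (xs @ b # ys)"
    "?g (xs @ s c a # ys) = s' c (?g (xs @ a # ys))" for xs a b ys c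
  proof -
    have "?g (xs @ (a + b) # ys) = ?g (xs @ a # ys) + ?g (xs @ b # ys)
        \<and> ?g (xs @ s c a # ys) = s' c (?g (xs @ a # ys))"
    proof (cases "Suc (length xs + length ys) = 2")
      case True
      then have "length (xs @ undefined # ys) = 2" by simp
      then show ?thesis by (rule two_element_split) (simp_all add: lin)
    next
      case False
      have "?g zs = 0" if "length zs \<noteq> 2" for zs
        using that by (auto split: list.splits)
      with False have "?g (xs @ a # ys) = 0" for a by simp
      then show ?thesis by simp
    qed
    then show "?g (xs @ (a + b) # ys) = ?g (xs @ a # ys) + ?g (xs @ b # ys)"
      "?g (xs @ s c a # ys) = s' c (?g (xs @ a # ys))" by blast+
  qed
  note cls = tensor_lift_tensor_class[of s' ?g s, OF W.vector_space_axioms g, folded tensor2_lift_def]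
  interpret L: Vector_Spaces.linear formal_scale s' "linear_extension s' ?g"
    by (rule linear_linear_extension) unfold_locales
  show "tensor2_lift s' f (tensor_add s t u) = tensor2_lift s' f t + tensor2_lift s' f u"
    if "t \<in> tensors s" "u \<in> tensors s"
    using that by (auto simp: tensor_add_class cls L.add elim!: tensorsE)
  show "tensor2_lift s' f (tensor_scale s c t) = s' c (tensor2_lift s' f t)" if "t \<in> tensors s"
    using that by (auto simp: tensor_scale_class cls L.scale elim!: tensorsE)
  show "tensor2_lift s' f (tensor_zero s) = 0"
    by (simp add: tensor_zero_def cls)
  show "tensor2_lift s' f (pure_tensor s [x, y]) = f x y"
    using tensor_lift_pure_tensor[of s' ?g s, OF W.vector_space_axioms g, of "[x, y]"]
    by (simp add: tensor2_lift_def)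
qed

text \<open>
  Transports a contraction of a tensor, such as \<open>\<epsilon> \<otimes> id\<close> or the right-hand side of the weak
  counit axiom, along linear maps \<open>g\<close> of the arguments and \<open>h\<close> of the values.
\<close>
lemma tensor2_lift_natural:
  assumes f: "bilinear_map s s' f" and f': "bilinear_map r r' f'"
    and g: "Vector_Spaces.linear s r g" and h: "Vector_Spaces.linear s' r' h"
    and comm: "\<And>x y. f' (g x) (g y) = h (f x y)"
    and "t \<in> tensor_power s 2"
  shows "tensor2_lift r' f' (tensor_power_map r g t) = h (tensor2_lift s' f t)"
proof -
  interpret h: Vector_Spaces.linear s' r' h by fact
  note J = tensor_power_map_linear[OF g]
  note L = tensor2_lift_linear[OF f] and L' = tensor2_lift_linear[OF f']
  show ?thesis
    using assms(6)
  proof (induction rule: tensor_power_induct)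
    case zero
    then show ?case by (simp add: tensor_linear_zero[OF J(1)] L L')
  next
    case (add t u)
    then show ?case by (simp add: tensor_linearD[OF J(1)] L L' h.add)
  next
    case (pure c xs)
    then obtain x y where "xs = [x, y]" by (rule length_2_cases)
    then show ?case by (simp add: tensor_linearD[OF J(1)] J(2) L L' h.scale comm)
  qed
qed


section \<open>Compatibility of induced maps with products and comultiplications\<close>

text \<open>
  The tensor powers of a linear map form an algebra map of tensor algebras. The equation is linear in
  \<open>u\<close> and in \<open>t\<close>, and for pure tensors it is \<open>map_append\<close>.
\<close>
lemma tensor_power_map_prod:
  assumes g: "Vector_Spaces.linear s s' g" and t: "t \<in> tensors s" and u: "u \<in> tensors s"
  shows "tensor_power_map s' g (tensor_prod s t u)
    = tensor_prod s' (tensor_power_map s' g t) (tensor_power_map s' g u)"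
proof -
  note J = tensor_power_map_linear[OF g]
  note Jc = tensor_linearD(1)[OF J(1)]
  have 1: "tensor_power_map s' g (tensor_prod s (pure_tensor s xs) u)
    = tensor_prod s' (tensor_power_map s' g (pure_tensor s xs)) (tensor_power_map s' g u)" for xs
    by (rule tensor_linear_eq[where s' = s', OF _ _ _ u])
      (simp_all add: tensor_linear_compose[OF tensor_prod_bilinear(2) J(1)]
        tensor_linear_compose[OF J(1) tensor_prod_bilinear(2)] Jc J(2) tensor_prod_bilinear(3))
  show ?thesis
    by (rule tensor_linear_eq[where s' = s', OF _ _ _ t])
      (simp_all add: 1 tensor_linear_compose[OF tensor_prod_bilinear(1) J(1)]
        tensor_linear_compose[OF J(1) tensor_prod_bilinear(1)] Jc u)
qed

lemma tensor_power_map_componentwise_mult: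
  assumes g: "Vector_Spaces.linear s s' g" and t: "t \<in> tensors s" and u: "u \<in> tensors s"
    and m: "bilinear_map s s m" and m': "bilinear_map s' s' m'"
    and mult: "\<And>x y. g (m x y) = m' (g x) (g y)"
  shows "tensor_power_map s' g (componentwise_mult s m t u)
    = componentwise_mult s' m' (tensor_power_map s' g t) (tensor_power_map s' g u)"
proof -
  note J = tensor_power_map_linear[OF g]
  note Jc = tensor_linearD(1)[OF J(1)]
  note M = componentwise_mult_bilinear[OF m] and M' = componentwise_mult_bilinear[OF m']
  have map: "map g (map2 m xs ys) = map2 m' (map g xs) (map g ys)" for xs ys
    by (induction xs ys rule: list_induct2') (simp_all add: mult)
  have 1: "tensor_power_map s' g (componentwise_mult s m (pure_tensor s xs) u)
    = componentwise_mult s' m' (tensor_power_map s' g (pure_tensor s xs)) (tensor_power_map s' g u)" for xs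
    by (rule tensor_linear_eq[where s' = s', OF _ _ _ u])
      (simp_all add: tensor_linear_compose[OF M(2) J(1)] tensor_linear_compose[OF J(1) M'(2)]
        Jc J(2) M(3) M'(3) map tensor_linear_zero[OF J(1)] del: map_map)
  show ?thesis
    by (rule tensor_linear_eq[where s' = s', OF _ _ _ t])
      (simp_all add: 1 tensor_linear_compose[OF M(1) J(1)] tensor_linear_compose[OF J(1) M'(1)] Jc u)
qed

lemma comult_left_linear:
  assumes D: "linear_to_tensors s s D"
  shows "tensor_linear s s (comult_left s D)"
    and "comult_left s D (pure_tensor s [x, y]) = tensor_prod s (D x) (pure_tensor s [y])"
proof -
  have "linear_to_tensors s s (\<lambda>x. tensor_prod s (D x) (pure_tensor s [y]))" for y
    by (rule linear_to_tensors_compose[OF D tensor_prod_bilinear(1)]) simp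
  moreover have "linear_to_tensors s s (\<lambda>y. tensor_prod s (D x) (pure_tensor s [y]))" for x
    using linear_to_tensors_compose[OF multilinear_to_tensorsD(1)[OF multilinear_pure_tensor, of s "[]" "[]"]
        tensor_prod_bilinear(2)[OF linear_to_tensorsD(1)[OF D]]] by simp
  ultimately show "tensor_linear s s (comult_left s D)"
    "comult_left s D (pure_tensor s [x, y]) = tensor_prod s (D x) (pure_tensor s [y])"
    unfolding comult_left_def by (rule tensor2_lift_tensor_linear)+
qed

lemma comult_right_linear:
  assumes D: "linear_to_tensors s s D"
  shows "tensor_linear s s (comult_right s D)"
    and "comult_right s D (pure_tensor s [x, y]) = tensor_prod s (pure_tensor s [x]) (D y)"
proof -
  have "linear_to_tensors s s (\<lambda>y. tensor_prod s (pure_tensor s [x]) (D y))" for x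
    by (rule linear_to_tensors_compose[OF D tensor_prod_bilinear(2)]) simp
  moreover have "linear_to_tensors s s (\<lambda>x. tensor_prod s (pure_tensor s [x]) (D y))" for y
    using linear_to_tensors_compose[OF multilinear_to_tensorsD(1)[OF multilinear_pure_tensor, of s "[]" "[]"]
        tensor_prod_bilinear(1)[OF linear_to_tensorsD(1)[OF D]]] by simp
  ultimately show "tensor_linear s s (comult_right s D)"
    "comult_right s D (pure_tensor s [x, y]) = tensor_prod s (pure_tensor s [x]) (D y)"
    unfolding comult_right_def by (intro tensor2_lift_tensor_linear; blast)+
qed

text \<open>
  A coalgebra map \<open>g\<close> also intertwines the twofold comultiplications. With the next lemma,
  this carries coassociativity along \<open>g\<close>.
\<close>
lemma comult_left_power_map:
  assumes D: "linear_to_tensors s s D" and D': "linear_to_tensors s' s' D'"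
    and g: "Vector_Spaces.linear s s' g"
    and comm: "\<And>x. D' (g x) = tensor_power_map s' g (D x)"
    and t: "t \<in> tensor_power s 2"
  shows "comult_left s' D' (tensor_power_map s' g t) = tensor_power_map s' g (comult_left s D t)"
proof (rule tensor_linear_eq_on_power[OF _ _ _ t])
  note J = tensor_power_map_linear[OF g]
  show "tensor_linear s s' (\<lambda>t. comult_left s' D' (tensor_power_map s' g t))"
    "tensor_linear s s' (\<lambda>t. tensor_power_map s' g (comult_left s D t))"
    by (intro tensor_linear_compose[OF J(1)] tensor_linear_compose[OF _ J(1)] comult_left_linear D D')+
  fix xs :: "'b list" assume "length xs = 2"
  then obtain x y where "xs = [x, y]" by (rule length_2_cases)
  then show "comult_left s' D' (tensor_power_map s' g (pure_tensor s xs))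
      = tensor_power_map s' g (comult_left s D (pure_tensor s xs))"
    by (simp add: J(2) comult_left_linear(2)[OF D] comult_left_linear(2)[OF D'] comm
        tensor_power_map_prod[OF g linear_to_tensorsD(1)[OF D]])
qed

lemma comult_right_power_map:
  assumes D: "linear_to_tensors s s D" and D': "linear_to_tensors s' s' D'"
    and g: "Vector_Spaces.linear s s' g"
    and comm: "\<And>x. D' (g x) = tensor_power_map s' g (D x)"
    and t: "t \<in> tensor_power s 2"
  shows "comult_right s' D' (tensor_power_map s' g t) = tensor_power_map s' g (comult_right s D t)"
proof (rule tensor_linear_eq_on_power[OF _ _ _ t])
  note J = tensor_power_map_linear[OF g]
  show "tensor_linear s s' (\<lambda>t. comult_right s' D' (tensor_power_map s' g t))"
    "tensor_linear s s' (\<lambda>t. tensor_power_map s' g (comult_right s D t))"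
    by (intro tensor_linear_compose[OF J(1)] tensor_linear_compose[OF _ J(1)] comult_right_linear D D')+
  fix xs :: "'b list" assume "length xs = 2"
  then obtain x y where "xs = [x, y]" by (rule length_2_cases)
  then show "comult_right s' D' (tensor_power_map s' g (pure_tensor s xs))
      = tensor_power_map s' g (comult_right s D (pure_tensor s xs))"
    by (simp add: J(2) comult_right_linear(2)[OF D] comult_right_linear(2)[OF D'] comm
        tensor_power_map_prod[OF g _ linear_to_tensorsD(1)[OF D]])
qed

lemma linear_to_tensors_comult: "counital_coalgebra s \<Delta> \<epsilon> \<Longrightarrow> linear_to_tensors s s \<Delta>"
  by (auto simp: linear_to_tensors_def counital_coalgebra.comult_add counital_coalgebra.comult_scale
      dest: counital_coalgebra.comult_in tensor_power_subset)


section \<open>Splitting off a one-dimensional summand\<close>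

context bialgebra
begin

abbreviation "scale' \<equiv> adjoin_scale s"
abbreviation "mult' \<equiv> adjoin_mult s m"
abbreviation "comult' \<equiv> adjoin_comult s \<eta> \<Delta>"
abbreviation "counit' \<equiv> adjoin_counit \<epsilon>"

text \<open>
  The element \<open>x + a (e\<^sub>1 - e\<^sub>2)\<close>, where \<open>\<eta> 1\<close> is \<open>e\<^sub>2\<close>: the point with coordinates
  \<open>(x, a)\<close> in the direct sum decomposition, as opposed to the pair \<open>(x, a)\<close>, which stands
  for \<open>x + a e\<^sub>1\<close>.
\<close>
definition combine :: "'v \<Rightarrow> 'k \<Rightarrow> 'v \<times> 'k" where
  "combine x a = (x - s a (\<eta> 1), a)"

abbreviation "incl x \<equiv> combine x 0"
abbreviation "idem \<equiv> combine 0 1"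
abbreviation "incl_tensor \<equiv> tensor_power_map scale' incl"

lemma combine_surj: obtains x a where "z = combine x a"
  by (rule that[of "fst z + s (snd z) (\<eta> 1)" "snd z"]) (simp add: combine_def)

lemma vector_space_adjoin: "vector_space scale'"
  by unfold_locales (auto simp: adjoin_scale_def algebra_simps)

lemma combine_add: "combine x a + combine y b = combine (x + y) (a + b)"
  by (simp add: combine_def algebra_simps)

lemma combine_scale: "scale' c (combine x a) = combine (s c x) (c * a)"
  by (simp add: combine_def adjoin_scale_def algebra_simps)

lemma combine_zero: "combine 0 0 = 0"
  by (simp add: combine_def zero_prod_def)

lemma unit_combine: "adjoin_unit 1 = combine (\<eta> 1) 1"
  by (simp add: combine_def adjoin_unit_def)

lemma linear_incl: "Vector_Spaces.linear s scale' incl"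
  using vector_space_adjoin vector_space_axioms
  by (simp add: Vector_Spaces.linear_iff combine_add combine_scale)

lemma bilinear_mult: "bilinear_map s s m"
  using mult_linear_left mult_linear_right by (simp add: bilinear_map_def)

lemma mult_simps:
  "m (x + y) z = m x z + m y z" "m (s c x) z = s c (m x z)"
  "m z (x + y) = m z x + m z y" "m z (s c x) = s c (m z x)"
  using mult_linear_left mult_linear_right by (simp_all add: Vector_Spaces.linear_iff)

lemma mult_diff: "m (x - y) z = m x z - m y z" "m z (x - y) = m z x - m z y"
  by (metis mult_simps(1) diff_add_cancel add_diff_cancel)
    (metis mult_simps(3) diff_add_cancel add_diff_cancel)

lemma mult_zero: "m x 0 = 0" "m 0 x = 0"
  using mult_diff(2)[of x 0 0] mult_diff(1)[of 0 0 x] by simp_all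

lemma counit_simps: "\<epsilon> (x + y) = \<epsilon> x + \<epsilon> y" "\<epsilon> (s c x) = c * \<epsilon> x"
  using counit_linear by (auto simp: Vector_Spaces.linear_iff)

lemma counit_zero: "\<epsilon> 0 = 0"
  using counit_simps(2)[of 0 0] by simp

lemma counit_diff: "\<epsilon> (x - y) = \<epsilon> x - \<epsilon> y"
  by (metis counit_simps(1) diff_add_cancel add_diff_cancel)

text \<open>
  The sum is direct as a sum of algebras: the mixed terms vanish since \<open>e\<^sub>2\<close> is the unit of
  the bialgebra.
\<close>
lemma mult_combine: "mult' (combine x a) (combine y b) = combine (m x y) (a * b)"
  by (simp add: combine_def adjoin_mult_def mult_diff mult_simps mult_unit_left mult_unit_right
      algebra_simps)

text \<open>
  The prescribed \<open>\<epsilon>(e\<^sub>1) = 2\<close> gives \<open>\<epsilon>(e\<^sub>1 - e\<^sub>2) = 2 - 1 = 1\<close>.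
\<close>
lemma counit_combine: "counit' (combine x a) = \<epsilon> x + a"
  by (simp add: combine_def adjoin_counit_def counit_diff counit_simps counit_unit)

lemma bilinear_mult': "bilinear_map scale' scale' mult'"
  unfolding bilinear_map_def Vector_Spaces.linear_iff
  using vector_space_adjoin
  by (auto simp: adjoin_mult_def adjoin_scale_def mult_simps algebra_simps)

lemma counit_linear': "Vector_Spaces.linear scale' (*) counit'"
  using vector_space_adjoin counit_linear
  by (auto simp: Vector_Spaces.linear_iff adjoin_counit_def adjoin_scale_def algebra_simps)

lemmas incl_tensor_linear = tensor_power_map_linear[OF linear_incl]

lemma comult_tensors: "\<Delta> x \<in> tensors s"
  using comult_in tensor_power_subset by blast

lemma incl_comult_tensors: "incl_tensor (\<Delta> x) \<in> tensors scale'"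
  by (rule tensor_linearD(1)[OF incl_tensor_linear(1) comult_tensors])

text \<open>
  The sum is direct as a sum of coalgebras. In terms of the pair \<open>(x - a e\<^sub>2, a)\<close> the
  comultiplication contributes \<open>- a e\<^sub>2 \<otimes> e\<^sub>2\<close> from the first component and
  \<open>a e\<^sub>2 \<otimes> e\<^sub>2\<close> from \<open>\<Delta>(e\<^sub>1)\<close>; these cancel and only \<open>a (e\<^sub>1 - e\<^sub>2) \<otimes> (e\<^sub>1 - e\<^sub>2)\<close>
  remains.
\<close>
lemma comult_combine:
  "comult' (combine x a) = tensor_add scale' (incl_tensor (\<Delta> x))
     (tensor_scale scale' a (pure_tensor scale' [idem, idem]))"
proof -
  let ?y = "x - s a (\<eta> 1)"
  have "\<Delta> x = \<Delta> (?y + s a (\<eta> 1))" by simp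
  also have "\<dots> = tensor_add s (\<Delta> ?y) (tensor_scale s a (pure_tensor s [\<eta> 1, \<eta> 1]))"
    by (simp only: comult_add comult_scale comult_unit)
  finally have "incl_tensor (\<Delta> x) = tensor_add scale' (incl_tensor (\<Delta> ?y))
      (tensor_scale scale' a (pure_tensor scale' [incl (\<eta> 1), incl (\<eta> 1)]))"
    by (simp add: tensor_linearD[OF incl_tensor_linear(1)] incl_tensor_linear(2) comult_tensors)
  moreover have "(\<lambda>y. (y, 0)) = incl" "(0, 1) - (\<eta> 1, 0) = idem" "(\<eta> 1, 0) = incl (\<eta> 1)"
    by (auto simp: combine_def)
  ultimately show ?thesis
    by (simp add: adjoin_comult_def Let_def combine_def[of x a] tensor_scale_add tensor_add_assoc
        incl_comult_tensors tensor_add_commute[of scale' "tensor_scale scale' a (pure_tensor scale' [idem, idem])"]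
        del: diff_Pair)
qed

lemma comult_incl: "comult' (incl x) = incl_tensor (\<Delta> x)"
  by (simp add: comult_combine tensor_scale_simps tensor_add_zero incl_comult_tensors)

lemma comult_zero: "\<Delta> 0 = tensor_zero s"
  using comult_scale[of 0 0] comult_tensors[of 0] by (simp add: tensor_scale_simps)

lemma comult_idem: "comult' idem = pure_tensor scale' [idem, idem]"
  by (simp add: comult_combine comult_zero tensor_linear_zero[OF incl_tensor_linear(1)]
      tensor_scale_simps tensor_add_zero)

lemma comult_linear': "linear_to_tensors scale' scale' comult'"
proof (rule linear_to_tensorsI)
  note J = tensor_linearD[OF incl_tensor_linear(1)] comult_tensors incl_comult_tensors
  fix z w :: "'v \<times> 'k" and c :: 'k
  obtain x a where z: "z = combine x a" by (rule combine_surj)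
  obtain y b where w: "w = combine y b" by (rule combine_surj)
  show "comult' z \<in> tensors scale'" by (simp add: z comult_combine)
  show "comult' (z + w) = tensor_add scale' (comult' z) (comult' w)"
    by (simp add: z w combine_add comult_combine comult_add J tensor_scale_left_add tensor_add_swap)
  show "comult' (scale' c z) = tensor_scale scale' c (comult' z)"
    by (simp add: z combine_scale comult_combine comult_scale J tensor_scale_scale tensor_scale_add)
qed


section \<open>The weak bialgebra axioms for the direct sum\<close>

lemma unital_assoc_algebra_adjoin: "unital_assoc_algebra scale' mult' adjoin_unit"
proof -
  interpret V: vector_space scale' by (rule vector_space_adjoin)
  show ?thesis
  proof unfold_locales
    fix x y z :: "'v \<times> 'k"
    obtain x0 a where x: "x = combine x0 a" by (rule combine_surj)
    obtain y0 b where y: "y = combine y0 b" by (rule combine_surj)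
    obtain z0 c where z: "z = combine z0 c" by (rule combine_surj)
    show "mult' (mult' x y) z = mult' x (mult' y z)"
      by (simp add: x y z mult_combine mult_assoc mult.assoc)
    show "mult' (adjoin_unit 1) x = x" "mult' x (adjoin_unit 1) = x"
      by (simp_all add: x unit_combine mult_combine mult_unit_left mult_unit_right)
  qed (use bilinear_mult' in \<open>auto simp: bilinear_map_def Vector_Spaces.linear_iff adjoin_unit_def
        adjoin_scale_def algebra_simps\<close>)
qed

lemma bilinear_counit:
  assumes "Vector_Spaces.linear r (*) \<phi>"
  shows "bilinear_map r r (\<lambda>y z. r (\<phi> y) z)" "bilinear_map r r (\<lambda>y z. r (\<phi> z) y)"
proof -
  interpret Vector_Spaces.linear r "(*)" \<phi> by fact
  show "bilinear_map r r (\<lambda>y z. r (\<phi> y) z)" "bilinear_map r r (\<lambda>y z. r (\<phi> z) y)"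
    using vs1.vector_space_axioms unfolding bilinear_map_def Vector_Spaces.linear_iff
    by (auto simp: add scale vs1.scale_left_distrib vs1.scale_right_distrib mult.commute)
qed

lemma counital_coalgebra_adjoin: "counital_coalgebra scale' comult' counit'"
proof -
  interpret V: vector_space scale' by (rule vector_space_adjoin)
  note D = linear_to_tensors_comult[OF counital_coalgebra_axioms]
  show ?thesis
  proof unfold_locales
    fix z w :: "'v \<times> 'k" and c :: 'k
    show "comult' (z + w) = tensor_add scale' (comult' z) (comult' w)"
      "comult' (scale' c z) = tensor_scale scale' c (comult' z)"
      by (rule linear_to_tensorsD[OF comult_linear'])+
    obtain x a where z: "z = combine x a" by (rule combine_surj)
    have "incl_tensor (\<Delta> x) \<in> tensor_power scale' 2"
      by (rule tensor_linear_power[OF incl_tensor_linear(1) _ comult_in])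
        (simp add: incl_tensor_linear(2) tensor_power_closed)
    then show "comult' z \<in> tensor_power scale' 2"
      by (simp add: z comult_combine tensor_power_closed)
    \<comment> \<open>The coordinates of \<open>z\<close> stay folded: unfolding \<open>comult_combine\<close> everywhere would
        also expand \<open>comult' idem\<close> and \<open>comult' (incl x)\<close>, which have simpler values.\<close>
    have comult_z: "comult' z = tensor_add scale' (incl_tensor (\<Delta> x))
        (tensor_scale scale' a (pure_tensor scale' [idem, idem]))"
      by (simp add: z comult_combine)
    note L = comult_left_linear[OF comult_linear'] and R = comult_right_linear[OF comult_linear']
    show "comult_left scale' comult' (comult' z) = comult_right scale' comult' (comult' z)"
      by (simp add: comult_z tensor_linearD[OF L(1)] tensor_linearD[OF R(1)] L(2) R(2)
          incl_comult_tensors comult_idem tensor_prod_bilinear(3) coassoc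
          comult_left_power_map[OF D comult_linear' linear_incl comult_incl comult_in]
          comult_right_power_map[OF D comult_linear' linear_incl comult_incl comult_in])
    note B = bilinear_counit[OF counit_linear] and B' = bilinear_counit[OF counit_linear']
    have "tensor2_lift scale' (\<lambda>y z. scale' (counit' y) z) (incl_tensor (\<Delta> x)) = incl x"
      using tensor2_lift_natural[OF B(1) B'(1) linear_incl linear_incl _ comult_in, of x]
      by (simp add: counit_combine combine_scale counit_left)
    then show "tensor2_lift scale' (\<lambda>y z. scale' (counit' y) z) (comult' z) = z"
      by (simp add: z comult_combine tensor2_lift_linear[OF B'(1)] incl_comult_tensors counit_combine
          counit_zero combine_add combine_scale)
    have "tensor2_lift scale' (\<lambda>y z. scale' (counit' z) y) (incl_tensor (\<Delta> x)) = incl x"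
      using tensor2_lift_natural[OF B(2) B'(2) linear_incl linear_incl _ comult_in, of x]
      by (simp add: counit_combine combine_scale counit_right)
    then show "tensor2_lift scale' (\<lambda>y z. scale' (counit' z) y) (comult' z) = z"
      by (simp add: z comult_combine tensor2_lift_linear[OF B'(2)] incl_comult_tensors counit_combine
          counit_zero combine_add combine_scale)
  qed (use counit_linear' in \<open>auto simp: Vector_Spaces.linear_iff algebra_simps\<close>)
qed

text \<open>
  Tensors from different summands annihilate each other: for pure tensors each factor of the product
  is of the form \<open>incl x \<cdot> idem\<close> or \<open>idem \<cdot> incl x\<close>, which is zero.
\<close>
lemma incl_tensor_orthogonal:
  assumes "t \<in> tensor_power s 2"
  shows "componentwise_mult scale' mult' (incl_tensor t) (pure_tensor scale' [idem, idem]) = tensor_zero scale'"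
    and "componentwise_mult scale' mult' (pure_tensor scale' [idem, idem]) (incl_tensor t) = tensor_zero scale'"
proof -
  note C = componentwise_mult_bilinear[OF bilinear_mult']
  note zero = pure_tensor_zero[OF vector_space_adjoin]
  have pure: "\<exists>x y. xs = [x, y]" if "length xs = 2" for xs :: "'v list"
    using that by (auto elim: length_2_cases)
  show "componentwise_mult scale' mult' (incl_tensor t) (pure_tensor scale' [idem, idem]) = tensor_zero scale'"
    by (rule tensor_linear_eq_on_power[where s' = scale', OF _ tensor_linear_zero_map _ assms])
      (auto intro!: tensor_linear_compose[OF incl_tensor_linear(1) C(1)] zero dest!: pure
        simp: incl_tensor_linear(2) C(3) mult_combine mult_zero combine_zero)
  show "componentwise_mult scale' mult' (pure_tensor scale' [idem, idem]) (incl_tensor t) = tensor_zero scale'"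
    by (rule tensor_linear_eq_on_power[where s' = scale', OF _ tensor_linear_zero_map _ assms])
      (auto intro!: tensor_linear_compose[OF incl_tensor_linear(1) C(2)] zero dest!: pure
        simp: incl_tensor_linear(2) C(3) mult_combine mult_zero combine_zero)
qed

lemma comult_mult':
  "comult' (mult' z w) = componentwise_mult scale' mult' (comult' z) (comult' w)"
proof -
  note C = componentwise_mult_bilinear[OF bilinear_mult']
  note Cl = tensor_linearD[OF C(1)] and Cr = tensor_linearD[OF C(2)]
  obtain x a where z: "z = combine x a" by (rule combine_surj)
  obtain y b where w: "w = combine y b" by (rule combine_surj)
  have "incl_tensor (\<Delta> (m x y))
      = componentwise_mult scale' mult' (incl_tensor (\<Delta> x)) (incl_tensor (\<Delta> y))"
    unfolding comult_mult
    by (rule tensor_power_map_componentwise_mult[OF linear_incl comult_tensors comult_tensors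
          bilinear_mult bilinear_mult']) (simp add: mult_combine)
  then show ?thesis
    by (simp add: z w mult_combine comult_combine Cl Cr incl_comult_tensors
        incl_tensor_orthogonal[OF comult_in] C(3) mult_zero tensor_scale_zero tensor_add_zero
        tensor_scale_scale mult.commute)
qed

lemma comult_unit': "comult' (adjoin_unit 1)
   = tensor_add scale' (pure_tensor scale' [incl (\<eta> 1), incl (\<eta> 1)]) (pure_tensor scale' [idem, idem])"
  by (simp add: unit_combine comult_combine comult_unit incl_tensor_linear(2) tensor_scale_simps)

lemma comult_left_unit':
  "comult_left scale' comult' (comult' (adjoin_unit 1)) =
     tensor_add scale' (pure_tensor scale' [incl (\<eta> 1), incl (\<eta> 1), incl (\<eta> 1)])
       (pure_tensor scale' [idem, idem, idem])"
  using comult_left_linear[OF comult_linear']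
  by (simp add: comult_unit' tensor_linearD comult_idem comult_incl comult_unit
      incl_tensor_linear(2) tensor_prod_bilinear(3))

text \<open>
  With \<open>e\<^sub>1 = e\<^sub>2 + f\<close>, of the four products of \<open>e\<^sub>2 \<otimes> e\<^sub>2 \<otimes> e\<^sub>1\<close> and
  \<open>f \<otimes> f \<otimes> e\<^sub>1\<close> with \<open>e\<^sub>1 \<otimes> e\<^sub>2 \<otimes> e\<^sub>2\<close> and \<open>e\<^sub>1 \<otimes> f \<otimes> f\<close> the mixed ones vanish
  in the middle factor.
\<close>
lemma weak_unit':
  defines "E \<equiv> pure_tensor scale' [adjoin_unit 1]"
  shows "componentwise_mult scale' mult' (tensor_prod scale' (comult' (adjoin_unit 1)) E)
      (tensor_prod scale' E (comult' (adjoin_unit 1))) =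
     tensor_add scale' (pure_tensor scale' [incl (\<eta> 1), incl (\<eta> 1), incl (\<eta> 1)])
       (pure_tensor scale' [idem, idem, idem])" (is ?left)
    and "componentwise_mult scale' mult' (tensor_prod scale' E (comult' (adjoin_unit 1)))
      (tensor_prod scale' (comult' (adjoin_unit 1)) E) =
     tensor_add scale' (pure_tensor scale' [incl (\<eta> 1), incl (\<eta> 1), incl (\<eta> 1)])
       (pure_tensor scale' [idem, idem, idem])" (is ?right)
proof -
  note C = componentwise_mult_bilinear[OF bilinear_mult']
  note C' = tensor_linearD[OF C(1)] tensor_linearD[OF C(2)]
  note P' = tensor_linearD(2)[OF tensor_prod_bilinear(1)] tensor_linearD(2)[OF tensor_prod_bilinear(2)]
    tensor_prod_bilinear(3)
  note zero = pure_tensor_zero[OF vector_space_adjoin]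
  show ?left ?right
    unfolding comult_unit' E_def
    by (simp_all add: P' C' C(3) unit_combine mult_combine mult_zero mult_unit_left combine_zero zero
        tensor_add_zero)
qed

text \<open>
  On the summand \<open>B\<close> the counit is multiplicative, so that the contraction is
  \<open>\<epsilon>(x) \<epsilon>(y\<^sub>(\<^sub>1\<^sub>)) \<epsilon>(y\<^sub>(\<^sub>2\<^sub>)) \<epsilon>(z) = \<epsilon>(x) \<epsilon>(y) \<epsilon>(z)\<close> by the counit law. It is the image of
  \<open>\<epsilon>(y\<^sub>(\<^sub>1\<^sub>)) y\<^sub>(\<^sub>2\<^sub>) = y\<close> under \<open>\<lambda>w. \<epsilon>(x) \<epsilon>(w) \<epsilon>(z)\<close>. The summand
  spanned by \<open>f\<close> contributes the product of the three coefficients to both sides.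
\<close>
lemma weak_counit':
  "counit' (mult' (mult' x y) z)
     = tensor2_lift (*) (\<lambda>u v. counit' (mult' x u) * counit' (mult' v z)) (comult' y)"
proof -
  obtain x0 a where x: "x = combine x0 a" by (rule combine_surj)
  obtain y0 b where y: "y = combine y0 b" by (rule combine_surj)
  obtain z0 c where z: "z = combine z0 c" by (rule combine_surj)
  let ?f = "\<lambda>u v. counit' (mult' x u) * counit' (mult' v z)"
  have B': "bilinear_map scale' (*) ?f"
    using bilinear_mult' counit_linear'
    by (simp add: bilinear_map_def Vector_Spaces.linear_iff algebra_simps del: split_paired_All)
  have h: "Vector_Spaces.linear s (*) (\<lambda>w. \<epsilon> x0 * \<epsilon> w * \<epsilon> z0)"
    using counit_linear by (auto simp: Vector_Spaces.linear_iff algebra_simps)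
  have "tensor2_lift (*) ?f (incl_tensor (\<Delta> y0)) = \<epsilon> x0 * \<epsilon> y0 * \<epsilon> z0"
    using tensor2_lift_natural[OF bilinear_counit(1)[OF counit_linear] B' linear_incl h _ comult_in, of y0]
    by (simp add: x z mult_combine counit_combine counit_mult counit_simps counit_left)
  then show ?thesis
    by (simp add: y comult_combine tensor2_lift_linear[OF B'] incl_comult_tensors)
      (simp add: x z mult_combine counit_combine counit_mult mult_zero counit_zero)
qed

lemma weak_bialgebra_adjoin: "weak_bialgebra scale' mult' adjoin_unit comult' counit'"
  by (intro weak_bialgebra.intro unital_assoc_algebra_adjoin counital_coalgebra_adjoin
      weak_bialgebra_axioms.intro comult_mult' weak_counit')
    (simp_all only: comult_left_unit' weak_unit')

end

theorem theorem2p10: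
  fixes s :: "'k::{alg_closed_field, field_char_0} \<Rightarrow> 'v::ab_group_add \<Rightarrow> 'v"
    and m :: "'v \<Rightarrow> 'v \<Rightarrow> 'v" and \<eta> :: "'k \<Rightarrow> 'v"
    and \<Delta> :: "'v \<Rightarrow> ('k, 'v) tensor" and \<epsilon> :: "'v \<Rightarrow> 'k"
  assumes "bialgebra s m \<eta> \<Delta> \<epsilon>"
  shows "weak_bialgebra (adjoin_scale s) (adjoin_mult s m) adjoin_unit
           (adjoin_comult s \<eta> \<Delta>) (adjoin_counit \<epsilon>)"
  using assms by (rule bialgebra.weak_bialgebra_adjoin)

end
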